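(* Let $(\mathcal{V},\circ,\langle\cdot,\cdot\rangle)$ be a Euclidean Jordan algebra of rank $n$, and let $\phi:\mathbb{R}\to\mathbb{R}$ be a nonnegative sublinear function. Suppose $A$ is an $n\times n$ real symmetric positive semidefinite matrix and $b\in\mathcal{V}$. Then, with Schur products taken relative to any (fixed) Jordan frame of $\mathcal{V}$, $$\phi\big(A\bullet b\big)\underset{w}{\prec}A\bullet\phi(b)\quad\text{and}\quad \lambda\big(\phi(A\bullet b)\big)\underset{w}{\prec}\lambda\big(\mathrm{diag}(A)\big)*\lambda\big(\phi(b)\big).$$ In particular, $$\lambda\big(|A\bullet b|\big)\underset{w}{\prec}\lambda\big(\mathrm{diag}(A)\big)*\lambda\big(|b|\big).$$
   Context: A Euclidean Jordan algebra $(\mathcal{V},\circ,\langle\cdot,\cdot\rangle)$ is a finite-dimensional real inner product space with a commutative bilinear product $\circ$ satisfying $x\circ(x^2\circ y)=x^2\circ(x\circ y)$ and $\langle x\circ y,z\rangle=\langle y,x\circ z\rangle$ (where $x^2=x\circ x$), with unit element $e$. A Jordan frame is a set $\{e_1,\dots,e_n\}$ of primitive idempotents with $e_i\circ e_j=0$ for $i\neq j$ and $\sum_i e_i=e$; the number $n$ is the rank of $\mathcal{V}$. Every $x\in\mathcal{V}$ has a spectral decomposition $x=x_1e_1+\cdots+x_ne_n$ for some Jordan frame, with the real numbers $x_i$ (the eigenvalues of $x$) uniquely determined up to order. $\lambda(x)\in\mathbb{R}^n$ denotes the vector of eigenvalues of $x$ in decreasing order, and $|x|:=\sum_i|x_i|e_i$.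 The inner product is the trace inner product $\langle x,y\rangle=\operatorname{tr}(x\circ y)$, where $\operatorname{tr}$ is the sum of eigenvalues. Schur product: given a Jordan frame $\{e_1,\dots,e_n\}$, one has the Peirce decomposition $\mathcal{V}=\sum_{i\leq j}\mathcal{V}_{ij}$ (orthogonal direct sum), where $\mathcal{V}_{ii}=\mathbb{R}e_i$ and $\mathcal{V}_{ij}=\{x: x\circ e_i=\tfrac12x=x\circ e_j\}$ for $i<j$. Writing $x=\sum_{i\leq j}x_{ij}$ with $x_{ij}\in\mathcal{V}_{ij}$, for a real symmetric $n\times n$ matrix $A=[a_{ij}]$ define $A\bullet x:=\sum_{i\leq j}a_{ij}x_{ij}$. $\mathrm{diag}(A)\in\mathbb{R}^n$ is the vector of diagonal entries of $A$ and $\lambda(\mathrm{diag}(A))$ is its decreasing rearrangement. A function $\phi:\mathbb{R}\to\mathbb{R}$ is sublinear if $\phi(\mu t)=\mu\phi(t)$ for all $\mu\geq 0$, $t\in\mathbb{R}$, and $\phi(t+s)\leq\phi(t)+\phi(s)$ for all $t,s\in\mathbb{R}$; nonnegative means $\phi(t)\ge0$ for all $t$. The corresponding Löwner map, also denoted $\phi:\mathcal{V}\to\mathcal{V}$, is $\phi(x):=\sum_i\phi(x_i)e_i$ when $x=\sum_i x_ie_i$ is the spectral decomposition. For $p,q\in\mathbb{R}^n$, $p*q$ is the componentwise product and $p^\downarrow$ the decreasing rearrangement of $p$. $p\underset{w}{\prec}q$ means $\sum_{i=1}^k p_i^\downarrow\leq\sum_{i=1}^k q_i^\downarrow$ for all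 $1\leq k\leq n$. For $x,y\in\mathcal{V}$, $x\underset{w}{\prec}y$ means $\lambda(x)\underset{w}{\prec}\lambda(y)$ in $\mathbb{R}^n$. *)

theory Defs
  imports "HOL-Analysis.Analysis" "Jordan_Normal_Form.Matrix"
begin

section \<open>Euclidean Jordan algebras\<close>

text \<open>
  The finite-dimensional real inner product space is a type of class \<open>euclidean_space\<close>; the Jordan
  product \<open>jp\<close> and the unit \<open>e\<close> are explicit parameters. The function \<open>inner\<close> is always written in
  prefix form because its infix symbol is also used for the scalar product of type \<open>vec\<close>.
\<close>

locale euclidean_jordan_algebra =
  fixes jp :: "'a::euclidean_space \<Rightarrow> 'a \<Rightarrow> 'a" and e :: 'a
  assumes bilinear_jp: "bilinear jp"
    and jp_commute: "jp x y = jp y x"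
    and jordan_identity: "jp x (jp (jp x x) y) = jp (jp x x) (jp x y)"
    and inner_jp: "inner (jp x y) z = inner y (jp x z)"
    and jp_unit: "jp x e = x"

definition idempotent :: "('a::euclidean_space \<Rightarrow> 'a \<Rightarrow> 'a) \<Rightarrow> 'a \<Rightarrow> bool" where
  "idempotent jp c \<longleftrightarrow> jp c c = c"

definition primitive_idempotent :: "('a::euclidean_space \<Rightarrow> 'a \<Rightarrow> 'a) \<Rightarrow> 'a \<Rightarrow> bool" where
  "primitive_idempotent jp c \<longleftrightarrow> idempotent jp c \<and> c \<noteq> 0 \<and>
     \<not> (\<exists>a b. idempotent jp a \<and> idempotent jp b \<and> a \<noteq> 0 \<and> b \<noteq> 0 \<and> c = a + b)"

text \<open>
  A Jordan frame of \<open>n\<close> elements is enumerated as \<open>c 0, \<dots>, c (n - 1)\<close>; values of \<open>c\<close> at other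
  indices are irrelevant. The \<open>c i\<close> are automatically distinct, being nonzero idempotents with
  vanishing mutual products.
\<close>

definition jordan_frame :: "('a::euclidean_space \<Rightarrow> 'a \<Rightarrow> 'a) \<Rightarrow> 'a \<Rightarrow> nat \<Rightarrow> (nat \<Rightarrow> 'a) \<Rightarrow> bool" where
  "jordan_frame jp e n c \<longleftrightarrow>
     (\<forall>i<n. primitive_idempotent jp (c i)) \<and>
     (\<forall>i<n. \<forall>j<n. i \<noteq> j \<longrightarrow> jp (c i) (c j) = 0) \<and>
     (\<Sum>i<n. c i) = e"

definition jordan_rank :: "('a::euclidean_space \<Rightarrow> 'a \<Rightarrow> 'a) \<Rightarrow> 'a \<Rightarrow> nat" where
  "jordan_rank jp e = (THE n. \<exists>c. jordan_frame jp e n c)"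


section \<open>Spectral decomposition\<close>

definition spectral_decomposition ::
  "('a::euclidean_space \<Rightarrow> 'a \<Rightarrow> 'a) \<Rightarrow> 'a \<Rightarrow> 'a \<Rightarrow> real list \<Rightarrow> (nat \<Rightarrow> 'a) \<Rightarrow> bool" where
  "spectral_decomposition jp e x ws c \<longleftrightarrow>
     jordan_frame jp e (length ws) c \<and> x = (\<Sum>i<length ws. (ws ! i) *\<^sub>R c i)"

text \<open>
  By the spectral theorem a decomposition exists for every \<open>x\<close>, the eigenvalues are unique up to
  order, and the Loewner map does not depend on the decomposition, so the choices below are
  immaterial in a Euclidean Jordan algebra. Vectors in \<open>\<real>\<^sup>n\<close> are real lists of length \<open>n\<close>.
\<close>

definition jordan_eigenvalues :: "('a::euclidean_space \<Rightarrow> 'a \<Rightarrow> 'a) \<Rightarrow> 'a \<Rightarrow> 'a \<Rightarrow> real list" where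
  "jordan_eigenvalues jp e x =
     (SOME ws. sorted_wrt (\<ge>) ws \<and> (\<exists>c. spectral_decomposition jp e x ws c))"

definition jordan_trace :: "('a::euclidean_space \<Rightarrow> 'a \<Rightarrow> 'a) \<Rightarrow> 'a \<Rightarrow> 'a \<Rightarrow> real" where
  "jordan_trace jp e x = sum_list (jordan_eigenvalues jp e x)"

definition loewner_map ::
  "('a::euclidean_space \<Rightarrow> 'a \<Rightarrow> 'a) \<Rightarrow> 'a \<Rightarrow> (real \<Rightarrow> real) \<Rightarrow> 'a \<Rightarrow> 'a" where
  "loewner_map jp e \<phi> x =
     (SOME y. \<exists>ws c. spectral_decomposition jp e x ws c \<and>
                     y = (\<Sum>i<length ws. \<phi> (ws ! i) *\<^sub>R c i))"

definition jordan_abs :: "('a::euclidean_space \<Rightarrow> 'a \<Rightarrow> 'a) \<Rightarrow> 'a \<Rightarrow> 'a \<Rightarrow> 'a" where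
  "jordan_abs jp e x = loewner_map jp e abs x"


section \<open>Peirce decomposition and Schur product\<close>

definition peirce_space ::
  "('a::euclidean_space \<Rightarrow> 'a \<Rightarrow> 'a) \<Rightarrow> (nat \<Rightarrow> 'a) \<Rightarrow> nat \<Rightarrow> nat \<Rightarrow> 'a set" where
  "peirce_space jp c i j =
     (if i = j then span {c i}
      else {x. jp x (c i) = (1/2) *\<^sub>R x \<and> jp x (c j) = (1/2) *\<^sub>R x})"

definition peirce_decomposition ::
  "('a::euclidean_space \<Rightarrow> 'a \<Rightarrow> 'a) \<Rightarrow> nat \<Rightarrow> (nat \<Rightarrow> 'a) \<Rightarrow> 'a \<Rightarrow> (nat \<Rightarrow> nat \<Rightarrow> 'a) \<Rightarrow> bool" where
  "peirce_decomposition jp n c x p \<longleftrightarrow>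
     (\<forall>j<n. \<forall>i\<le>j. p i j \<in> peirce_space jp c i j) \<and> x = (\<Sum>j<n. \<Sum>i\<le>j. p i j)"

text \<open>
  The Peirce components \<open>p i j\<close> (\<open>i \<le> j < n\<close>) of \<open>x\<close> exist and are unique when \<open>c\<close> is a Jordan frame
  of a Euclidean Jordan algebra, so the element below is well defined.
\<close>

definition schur_product ::
  "('a::euclidean_space \<Rightarrow> 'a \<Rightarrow> 'a) \<Rightarrow> nat \<Rightarrow> (nat \<Rightarrow> 'a) \<Rightarrow> real mat \<Rightarrow> 'a \<Rightarrow> 'a" where
  "schur_product jp n c A x =
     (THE y. \<exists>p. peirce_decomposition jp n c x p \<and>
                 y = (\<Sum>j<n. \<Sum>i\<le>j. (A $$ (i, j)) *\<^sub>R p i j))"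


section \<open>Matrices, majorization, sublinear functions\<close>

definition symmetric_psd :: "nat \<Rightarrow> real mat \<Rightarrow> bool" where
  "symmetric_psd n A \<longleftrightarrow> A \<in> carrier_mat n n \<and> transpose_mat A = A \<and>
     (\<forall>v \<in> carrier_vec n. 0 \<le> scalar_prod v (mult_mat_vec A v))"

definition decreasing :: "real list \<Rightarrow> real list" where
  "decreasing xs = rev (sort xs)"

definition cprod :: "real list \<Rightarrow> real list \<Rightarrow> real list" where
  "cprod xs ys = map2 (*) xs ys"

text \<open>
  Equality of lengths is part of the relation: both vectors lie in the same \<open>\<real>\<^sup>n\<close>.
\<close>

definition weakly_majorized :: "real list \<Rightarrow> real list \<Rightarrow> bool" where
  "weakly_majorized xs ys \<longleftrightarrow> length xs = length ys \<and>
     (\<forall>k\<in>{1..length xs}. sum_list (take k (decreasing xs)) \<le> sum_list (take k (decreasing ys)))"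

definition jordan_weakly_majorized ::
  "('a::euclidean_space \<Rightarrow> 'a \<Rightarrow> 'a) \<Rightarrow> 'a \<Rightarrow> 'a \<Rightarrow> 'a \<Rightarrow> bool" where
  "jordan_weakly_majorized jp e x y \<longleftrightarrow>
     weakly_majorized (jordan_eigenvalues jp e x) (jordan_eigenvalues jp e y)"

definition sublinear :: "(real \<Rightarrow> real) \<Rightarrow> bool" where
  "sublinear \<phi> \<longleftrightarrow> (\<forall>\<mu>\<ge>0. \<forall>t. \<phi> (\<mu> * t) = \<mu> * \<phi> t) \<and> (\<forall>t s. \<phi> (t + s) \<le> \<phi> t + \<phi> s)"

end

theory Submission
  imports Defs "HOL-Combinatorics.List_Permutation"
begin

text \<open>
  For a frame \<open>c\<close> and \<open>d = \<Sum>\<^sub>i v\<^sub>i c\<^sub>i\<close>, the Schur product with the rank-one matrix \<open>v v\<^sup>T\<close> is the quadratic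
  representation of \<open>d\<close>, which maps a primitive idempotent to a nonnegative multiple of an idempotent.
  Since a positive semidefinite matrix is a sum of such \<open>v v\<^sup>T\<close>, the Schur product with \<open>A\<close> preserves
  positivity. A nonnegative sublinear function satisfies \<open>\<phi> t = max (t \<phi>(1)) (- t \<phi>(-1))\<close>, so \<open>y = \<phi>(b)\<close>
  dominates \<open>\<phi>(1) b\<close> and \<open>- \<phi>(-1) b\<close>; applying the Schur product, the diagonal of the Schur product of \<open>y\<close>
  in an eigenframe of the Schur product of \<open>b\<close> dominates the eigenvalues of \<open>\<phi>\<close> of the latter. The
  first majorization then follows from Ky Fan's principle, with the spectral projections of trace \<open>k\<close> relaxed
  to effects \<open>0 \<le> q \<le> e\<close> of trace \<open>k\<close>. For the second one, \<open>y\<close> is written by Abel summation in terms of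
  partial sums of its eigenframe; for effects \<open>p\<close>, \<open>q\<close> of traces \<open>m\<close>, \<open>k\<close> the inner product of \<open>A \<bullet> p\<close> with
  \<open>q\<close> is at most that of \<open>A \<bullet> p\<close> with \<open>e\<close>, and symmetrically in \<open>p\<close> and \<open>q\<close>, hence at most the sum of the
  \<open>min m k\<close> largest diagonal entries of \<open>A\<close>.

  Under the trace inner product a primitive idempotent has norm \<open>1\<close>, so every frame has
  \<open>inner e e\<close> elements. The majorization argument works with whichever spectral
  decompositions the choice operators return, so uniqueness of eigenvalues plays no role.
\<close>

section \<open>First consequences of the Jordan identity\<close>

lemma inner_eqI: "(\<And>w. inner a w = inner b w) \<Longrightarrow> a = b" for a b :: "'a::real_inner"
  by (metis inner_eq_zero_iff inner_diff_left right_minus_eq)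

lemma inner_cong_left: "a = b \<Longrightarrow> inner a w = inner b w"
  by simp

context euclidean_jordan_algebra
begin

lemmas jp_simps =
  bilinear_ladd[OF bilinear_jp] bilinear_radd[OF bilinear_jp]
  bilinear_lmul[OF bilinear_jp] bilinear_rmul[OF bilinear_jp]
  bilinear_lneg[OF bilinear_jp] bilinear_rneg[OF bilinear_jp]
  bilinear_lsub[OF bilinear_jp] bilinear_rsub[OF bilinear_jp]
  bilinear_lzero[OF bilinear_jp] bilinear_rzero[OF bilinear_jp]

lemma linear_jp: "linear (jp x)"
  using bilinear_jp by (simp add: bilinear_def)

lemma jp_sum_right: "jp x (sum f I) = (\<Sum>i\<in>I. jp x (f i))"
  by (rule linear_sum[OF linear_jp])

lemma jp_sum_left: "jp (sum f I) x = (\<Sum>i\<in>I. jp (f i) x)"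
  by (simp add: jp_commute[of _ x] jp_sum_right)

lemma jp_unit_left: "jp e x = x"
  by (simp add: jp_commute[of e] jp_unit)

lemma inner_jp_left: "inner (jp x y) z = inner x (jp y z)"
  by (metis inner_jp jp_commute)

text \<open>Because the product is self-adjoint,
  \<open>inner x x = inner (jp x x) e\<close>.\<close>

lemma jp_square_eq_0: "jp x x = 0 \<Longrightarrow> x = 0"
  by (metis inner_eq_zero_iff inner_jp_left inner_zero_left jp_unit)

text \<open>The part of the Jordan identity that is linear in \<open>z\<close> after substituting \<open>x \<plusminus> z\<close> for \<open>x\<close>.\<close>

lemma linearized_jordan:
  "jp z (jp (jp x x) y) + 2 *\<^sub>R jp x (jp (jp x z) y)
   = jp (jp x x) (jp z y) + 2 *\<^sub>R jp (jp x z) (jp x y)"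
\<comment> \<open>Pairing with an arbitrary \<open>w\<close> gives equations between reals, open to
  linear arithmetic. The instance at \<open>x + z\<close> minus that at \<open>x - z\<close> leaves
  twice the part linear in \<open>z\<close> plus twice the instance at \<open>z\<close>.\<close>
proof (rule inner_eqI)
  fix w
  have c: "jp z x = jp x z" by (rule jp_commute)
  show "inner (jp z (jp (jp x x) y) + 2 *\<^sub>R jp x (jp (jp x z) y)) w
     = inner (jp (jp x x) (jp z y) + 2 *\<^sub>R jp (jp x z) (jp x y)) w"
    using jordan_identity[of "x + z" y, THEN inner_cong_left, of w]
      jordan_identity[of "x - z" y, THEN inner_cong_left, of w]
      jordan_identity[of z y, THEN inner_cong_left, of w]
      jordan_identity[of x y, THEN inner_cong_left, of w]
    by (simp add: jp_simps c inner_simps)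
qed

text \<open>This is \<open>linearized_jordan\<close> solved for its first term. Read as operators
  acting on \<open>z\<close>, it expresses multiplication by x^2 y through multiplications by
  \<open>x\<close>, \<open>y\<close>, x^2 and xy.\<close>

lemma jp_square_product:
  "jp (jp (jp x x) y) z =
   jp (jp x x) (jp y z) + 2 *\<^sub>R jp (jp x y) (jp x z) - 2 *\<^sub>R jp x (jp y (jp x z))"
proof -
  have "jp z (jp (jp x x) y) + 2 *\<^sub>R jp x (jp (jp x z) y)
   = jp (jp x x) (jp z y) + 2 *\<^sub>R jp (jp x z) (jp x y)"
    by (rule linearized_jordan)
  then show ?thesis
    by (simp add: jp_commute algebra_simps)
qed

section \<open>Peirce decomposition relative to one idempotent\<close>

lemma idempotent_linearized:
  assumes "jp c c = c"
  shows "jp z (jp c y) + 2 *\<^sub>R jp c (jp (jp c z) y) = jp c (jp z y) + 2 *\<^sub>R jp (jp c z) (jp c y)"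
  using linearized_jordan[of z c y] assms by simp

lemma peirce_0_0:
  assumes "jp c c = c" "jp c x = 0" "jp c y = 0"
  shows "jp c (jp x y) = 0"
  using idempotent_linearized[OF assms(1), of x y] assms by (simp add: jp_simps)

lemma peirce_1_1:
  assumes "jp c c = c" "jp c x = x" "jp c y = y"
  shows "jp c (jp x y) = jp x y"
  using idempotent_linearized[OF assms(1), of x y] assms by (simp add: jp_simps)

lemma peirce_1_0:
  assumes "jp c c = c" "jp c x = x" "jp c y = 0"
  shows "jp x y = 0"
proof -
  have "2 *\<^sub>R jp c (jp x y) = jp c (jp x y)" "jp x y = jp c (jp x y)"
    using idempotent_linearized[OF assms(1), of x y] idempotent_linearized[OF assms(1), of y x] assms
    by (simp_all add: jp_simps jp_commute[of y x])
  then show ?thesis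
    by (simp add: scaleR_2)
qed

lemma peirce_0_half:
  assumes "jp c c = c" "jp c x = 0" "jp c y = (1/2) *\<^sub>R y"
  shows "jp c (jp x y) = (1/2) *\<^sub>R jp x y"
  using idempotent_linearized[OF assms(1), of x y] assms by (simp add: jp_simps)

text \<open>The square of a 1/2-eigenvector has no component with eigenvalue 1/2. Hence its image
  under \<open>c\<close> is fixed by \<open>c\<close>, and so is a multiple of \<open>c\<close> when
  \<open>c\<close> is primitive.\<close>

lemma peirce_half_half:
  assumes "jp c c = c" "jp c h = (1/2) *\<^sub>R h"
  shows "jp c (jp c (jp h h)) = jp c (jp h h)"
  using linearized_jordan[of c h c] assms
  by (simp add: jp_simps jp_commute)

text \<open>An instance of \<open>jp_square_product\<close> with both factors \<open>c\<close>. The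
  polynomial 2t^3 - 3t^2 + t has the roots 0, 1/2 and 1, the only possible eigenvalues of
  multiplication by \<open>c\<close>.\<close>

lemma idempotent_cubic:
  assumes "jp c c = c"
  shows "2 *\<^sub>R jp c (jp c (jp c y)) = 3 *\<^sub>R jp c (jp c y) - jp c y"
proof (rule inner_eqI)
  fix w
  show "inner (2 *\<^sub>R jp c (jp c (jp c y))) w = inner (3 *\<^sub>R jp c (jp c y) - jp c y) w"
    using jp_square_product[of c c y, THEN inner_cong_left, of w] assms
    by (simp add: inner_simps)
qed

lemma peirce_decompose:
  assumes "jp c c = c"
  obtains x1 xh x0 where "x = x1 + xh + x0"
    "jp c x1 = x1" "jp c xh = (1/2) *\<^sub>R xh" "jp c x0 = 0"
proof
  \<comment> \<open>The Lagrange interpolation polynomials for the nodes 1, 1/2 and 0, evaluated at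
    multiplication by \<open>c\<close> and applied to \<open>x\<close>;
    \<open>idempotent_cubic\<close> makes the values eigenvectors.\<close>
  let ?x1 = "2 *\<^sub>R jp c (jp c x) - jp c x"
  let ?xh = "4 *\<^sub>R jp c x - 4 *\<^sub>R jp c (jp c x)"
  let ?x0 = "x - 3 *\<^sub>R jp c x + 2 *\<^sub>R jp c (jp c x)"
  show "x = ?x1 + ?xh + ?x0"
    by (rule inner_eqI) (simp add: inner_simps)
  have k: "2 * inner (jp c (jp c (jp c x))) w = 3 * inner (jp c (jp c x)) w - inner (jp c x) w" for w
    using idempotent_cubic[OF assms, of x, THEN inner_cong_left, of w] by (simp add: inner_simps)
  show "jp c ?x1 = ?x1"
  proof (rule inner_eqI)
    fix w show "inner (jp c ?x1) w = inner (?x1) w"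
      using k[of w] by (simp add: inner_simps jp_simps)
  qed
  show "jp c ?xh = (1/2) *\<^sub>R ?xh"
  proof (rule inner_eqI)
    fix w show "inner (jp c ?xh) w = inner ((1/2) *\<^sub>R ?xh) w"
      using k[of w] by (simp add: inner_simps jp_simps)
  qed
  show "jp c ?x0 = 0"
  proof (rule inner_eqI)
    fix w show "inner (jp c ?x0) w = inner (0) w"
      using k[of w] by (simp add: inner_simps jp_simps)
  qed
qed

lemma inner_peirce:
  assumes "jp c x = a *\<^sub>R x" "jp c y = b *\<^sub>R y" "a \<noteq> b"
  shows "inner x y = 0"
proof -
  have "a * inner x y = b * inner x y"
    using inner_jp[of c x y] assms by simp
  then show ?thesis using assms(3) by simp
qed

text \<open>The Peirce components of \<open>x\<close> are orthogonal and have eigenvalues 1, 1/2 and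
  0, so the form is a nonnegative combination of squared norms; when it vanishes, only the component
  for 0 survives.\<close>

lemma inner_idempotent:
  assumes c: "jp c c = c"
  shows "0 \<le> inner (jp c x) x" and "inner (jp c x) x = 0 \<Longrightarrow> jp c x = 0"
proof -
  obtain x1 xh x0 where x: "x = x1 + xh + x0"
    "jp c x1 = x1" "jp c xh = (1/2) *\<^sub>R xh" "jp c x0 = 0"
    using peirce_decompose[OF c] by metis
  have o: "inner x1 xh = 0" "inner x1 x0 = 0" "inner xh x0 = 0"
    using inner_peirce[of c x1 1 xh "1/2"] inner_peirce[of c x1 1 x0 0]
      inner_peirce[of c xh "1/2" x0 0] x by auto
  have eq: "inner (jp c x) x = inner x1 x1 + inner xh xh / 2"
    using o by (simp add: x jp_simps inner_simps inner_commute)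
  show "0 \<le> inner (jp c x) x"
    by (simp add: eq)
  assume "inner (jp c x) x = 0"
  then have "inner x1 x1 = 0" "inner xh xh = 0"
    using eq inner_ge_zero[of x1] inner_ge_zero[of xh] by linarith+
  then show "jp c x = 0"
    by (simp add: x jp_simps)
qed

lemma inner_idempotents_nonneg:
  assumes "jp c c = c" "jp d d = d"
  shows "0 \<le> inner c d"
  using inner_idempotent(1)[OF assms(1), of d] by (simp add: assms inner_jp_left)

lemma jp_idempotents_eq_0:
  assumes "jp c c = c" "jp d d = d" "inner c d = 0"
  shows "jp c d = 0"
  using inner_idempotent(2)[OF assms(1), of d] by (simp add: assms inner_jp_left)

text \<open>In both identities the terms containing \<open>jp c d\<close> drop out. The second part
  puts \<open>jp c (jp d x)\<close> into the 1/2-space of \<open>c\<close>, and by symmetry of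
  \<open>d\<close>; this yields the off-diagonal Peirce components.\<close>

lemma jp_orthogonal_idempotents:
  assumes c: "jp c c = c" and d: "jp d d = d" and cd: "jp c d = 0"
  shows "jp c (jp d x) = jp d (jp c x)" and "2 *\<^sub>R jp c (jp c (jp d x)) = jp c (jp d x)"
proof -
  show a: "jp c (jp d x) = jp d (jp c x)"
    using linearized_jordan[of d c x] by (simp add: c cd jp_simps)
  have "jp (jp c d) x = jp c (jp d x) - 2 *\<^sub>R jp c (jp d (jp c x))"
    using jp_square_product[of c d x] by (simp add: c cd jp_simps)
  then show "2 *\<^sub>R jp c (jp c (jp d x)) = jp c (jp d x)"
    by (simp add: cd a jp_simps)
qed

section \<open>Powers and the spectral theorem\<close>

primrec jpow :: "'a \<Rightarrow> nat \<Rightarrow> 'a" where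
  "jpow x 0 = e"
| "jpow x (Suc k) = jp x (jpow x k)"

lemma jp_square_jpow: "jp (jp x x) (jpow x k) = jpow x (k + 2)"
  by (induction k) (simp_all add: jp_unit jordan_identity[symmetric])

text \<open>Induction in steps of two: \<open>jp_square_product\<close> writes multiplication by the
  power \<open>l + 2\<close> through multiplications by \<open>x\<close>, its square and the powers
  \<open>l\<close> and \<open>l + 1\<close>. These commute with multiplication by \<open>x\<close>
  and its square, which is why both claims are carried together.\<close>

lemma jp_jpow_commute:
  "jp x (jp (jpow x k) z) = jp (jpow x k) (jp x z) \<and>
   jp (jp x x) (jp (jpow x k) z) = jp (jpow x k) (jp (jp x x) z)"
proof (induction k arbitrary: z rule: less_induct)
  case (less k)
  consider "k = 0" | "k = 1" | l where "k = l + 2"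
    by (metis One_nat_def add_2_eq_Suc' not0_implies_Suc)
  then show ?case
  proof cases
    case 1
    then show ?thesis by (simp add: jp_unit_left)
  next
    case 2
    then show ?thesis by (simp add: jp_unit jordan_identity)
  next
    case 3
    have p: "jp (jpow x k) z = jp (jp x x) (jp (jpow x l) z) + 2 *\<^sub>R jp (jpow x (Suc l)) (jp x z)
        - 2 *\<^sub>R jp x (jp (jpow x l) (jp x z))" for z
      unfolding 3 jp_square_jpow[symmetric] by (simp add: jp_square_product)
    have l: "jp x (jp (jpow x l) z) = jp (jpow x l) (jp x z)"
      "jp (jp x x) (jp (jpow x l) z) = jp (jpow x l) (jp (jp x x) z)" for z
      using less[of l z] 3 by auto
    have sl: "jp x (jp (jpow x (Suc l)) z) = jp (jpow x (Suc l)) (jp x z)"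
      "jp (jp x x) (jp (jpow x (Suc l)) z) = jp (jpow x (Suc l)) (jp (jp x x) z)" for z
      using less[of "Suc l" z] 3 by auto
    show ?thesis
      unfolding p by (simp only: jp_simps l sl jordan_identity)
  qed
qed

text \<open>Power associativity: the commutation just shown moves \<open>x\<close> out of the second
  factor.\<close>

lemma jp_jpow_jpow: "jp (jpow x k) (jpow x j) = jpow x (k + j)"
proof (induction j)
  case (Suc j)
  then show ?case using jp_jpow_commute[of x k "jpow x j"] by simp
qed (simp add: jp_unit)

end

section \<open>Self-adjoint maps on an invariant subspace\<close>

text \<open>The form evaluated at \<open>u - t *\<^sub>R f u\<close> has no constant term in
  \<open>t\<close>. To stay nonnegative it must lose its linear term, whose coefficient is a
  multiple of the squared norm of \<open>f u\<close>.\<close>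

lemma selfadjoint_psd_kernel:
  fixes f :: "'a::euclidean_space \<Rightarrow> 'a"
  assumes "linear f" and S: "subspace S" "\<And>v. v \<in> S \<Longrightarrow> f v \<in> S"
    and sa: "\<And>u v. inner (f u) v = inner u (f v)"
    and psd: "\<And>v. v \<in> S \<Longrightarrow> 0 \<le> inner (f v) v"
    and u: "u \<in> S" "inner (f u) u = 0"
  shows "f u = 0"
proof -
  interpret linear f by fact
  define a where "a = inner (f (f u)) (f u)"
  define b where "b = inner (f u) (f u)"
  have a: "0 \<le> a" and b: "0 \<le> b"
    unfolding a_def b_def using psd S u by auto
  have q: "0 \<le> t\<^sup>2 * a - 2 * t * b" for t
  proof -
    have "u - t *\<^sub>R f u \<in> S"
      using S u by (simp add: subspace_diff subspace_scale)
    from psd[OF this] have "0 \<le> inner (f u - t *\<^sub>R f (f u)) (u - t *\<^sub>R f u)"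
      by (simp add: diff scale)
    moreover have "inner (f (f u)) u = b"
      by (simp add: b_def sa)
    ultimately show ?thesis
      using u(2) by (simp add: inner_simps a_def b_def power2_eq_square algebra_simps inner_commute)
  qed
  have "b = 0"
  proof (cases "a = 0")
    case True
    then show ?thesis using q[of 1] b by simp
  next
    case False
    \<comment> \<open>The value \<open>b / a\<close> of \<open>t\<close> minimizes the
      quadratic.\<close>
    then have "0 \<le> (b / a)\<^sup>2 * a - 2 * (b / a) * b" using q by blast
    also have "\<dots> = - (b\<^sup>2 / a)" using False by (simp add: power2_eq_square field_simps)
    finally show ?thesis using a False by (simp add: divide_le_0_iff)
  qed
  then show ?thesis by (simp add: b_def)
qed

text \<open>The Rayleigh quotient attains its maximum \<open>w\<close> on the unit sphere of
  \<open>S\<close>. The form of \<open>w *\<^sub>R v - f v\<close> is then nonnegative on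
  \<open>S\<close> and vanishes at the maximizer, which therefore lies in the kernel.\<close>

lemma selfadjoint_max_eigenvector:
  fixes f :: "'a::euclidean_space \<Rightarrow> 'a"
  assumes "linear f" and S: "subspace S" "\<And>v. v \<in> S \<Longrightarrow> f v \<in> S"
    and sa: "\<And>u v. inner (f u) v = inner u (f v)"
    and x: "x \<in> S" "x \<noteq> 0"
  obtains u w where "u \<in> S" "u \<noteq> 0" "f u = w *\<^sub>R u" "\<And>v. v \<in> S \<Longrightarrow> inner (f v) v \<le> w * inner v v"
proof -
  interpret f: linear f by fact
  let ?K = "S \<inter> sphere 0 1"
  have "compact ?K"
    using closed_subspace[OF S(1)] by (simp add: closed_Int_compact)
  moreover have "x /\<^sub>R norm x \<in> ?K"
    using x S(1) by (simp add: subspace_scale)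
  moreover have "continuous_on ?K (\<lambda>v. inner (f v) v)"
    using linear_continuous_on[OF linear_conv_bounded_linear[THEN iffD1, OF \<open>linear f\<close>]]
    by (intro continuous_intros) auto
  ultimately have "\<exists>u\<in>?K. \<forall>v\<in>?K. inner (f v) v \<le> inner (f u) u"
    by (intro continuous_attains_sup) blast+
  then obtain u where u: "u \<in> S" "norm u = 1"
    and max: "\<And>v. v \<in> ?K \<Longrightarrow> inner (f v) v \<le> inner (f u) u"
    by auto
  define w where "w = inner (f u) u"
  have le: "inner (f v) v \<le> w * inner v v" if "v \<in> S" for v
  proof (cases "v = 0")
    case False
    have "v /\<^sub>R norm v \<in> ?K"
      using that False S(1) by (simp add: subspace_scale)
    then have "inner (f v) v / (norm v * norm v) \<le> w"
      using max[of "v /\<^sub>R norm v"] by (simp add: f.scale w_def field_simps)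
    then show ?thesis
      using False by (simp add: field_simps power2_norm_eq_inner[symmetric] power2_eq_square)
  qed (simp add: f.zero)
  have uu: "inner u u = 1"
    using u by (simp add: norm_eq_1)
  have "w *\<^sub>R u - f u = 0"
  proof (rule selfadjoint_psd_kernel[where f = "\<lambda>v. w *\<^sub>R v - f v" and S = S])
    show "linear (\<lambda>v. w *\<^sub>R v - f v)"
      by (intro linear_compose_sub linear_compose_scale_right linear_ident \<open>linear f\<close>)
  qed (use S u le uu in \<open>auto simp: subspace_diff subspace_scale inner_simps sa w_def\<close>)
  then show thesis
    using that[of u w] u le by fastforce
qed

section \<open>Idempotents in the subalgebra generated by one element\<close>

context euclidean_jordan_algebra
begin

text \<open>The exponents start at 1, so the unit is not forced in: if an idempotent annihilates
  \<open>x\<close>, then it annihilates all of \<open>powspan x\<close>.\<close>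

definition powspan :: "'a \<Rightarrow> 'a set" where
  "powspan x = span (range (\<lambda>k. jpow x (Suc k)))"

lemma subspace_powspan: "subspace (powspan x)"
  by (simp add: powspan_def)

lemma powspan_self: "x \<in> powspan x"
proof -
  have "jpow x (Suc 0) \<in> powspan x"
    unfolding powspan_def by (intro span_base rangeI)
  then show ?thesis by (simp add: jp_unit)
qed

lemma powspan_jp:
  assumes y: "y \<in> powspan x" and z: "z \<in> powspan x"
  shows "jp y z \<in> powspan x"
proof -
  have 1: "jp (jpow x (Suc i)) z \<in> powspan x" for i
    using z unfolding powspan_def
  proof (induction rule: span_induct)
    show "subspace {z. jp (jpow x (Suc i)) z \<in> span (range (\<lambda>k. jpow x (Suc k)))}"
      by (intro subspaceI) (auto simp: jp_simps span_add span_scale span_zero simp del: jpow.simps)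
  next
    fix z assume "z \<in> range (\<lambda>k. jpow x (Suc k))"
    then obtain j where "z = jpow x (Suc j)" by blast
    then have "jp (jpow x (Suc i)) z = jpow x (Suc (i + Suc j))"
      using jp_jpow_jpow[of x "Suc i" "Suc j"] by simp
    then show "jp (jpow x (Suc i)) z \<in> span (range (\<lambda>k. jpow x (Suc k)))"
      using span_base by (metis rangeI)
  qed
  show ?thesis
    using y unfolding powspan_def
  proof (induction rule: span_induct)
    show "subspace {y. jp y z \<in> span (range (\<lambda>k. jpow x (Suc k)))}"
      by (intro subspaceI) (auto simp: jp_simps span_add span_scale span_zero simp del: jpow.simps)
  qed (use 1 in \<open>auto simp: powspan_def simp del: jpow.simps\<close>)
qed

lemma powspan_minimal:
  assumes "subspace T" "x \<in> T" "\<And>y z. y \<in> T \<Longrightarrow> z \<in> T \<Longrightarrow> jp y z \<in> T"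
  shows "powspan x \<subseteq> T"
proof -
  have "jpow x (Suc k) \<in> T" for k
    by (induction k) (use assms in \<open>auto simp: jp_unit\<close>)
  then show ?thesis
    unfolding powspan_def using assms(1) by (intro span_minimal) auto
qed

text \<open>The largest eigenvalues of multiplication by \<open>x\<close> and by \<open>- x\<close>
  are taken. If both were 0, the quadratic form would vanish on the subspace, and the kernel lemma
  would give \<open>jp x x = 0\<close>.\<close>

lemma powspan_nonzero_eigenvector:
  assumes "x \<noteq> 0"
  obtains u w where "u \<in> powspan x" "u \<noteq> 0" "w \<noteq> 0" "jp x u = w *\<^sub>R u"
proof -
  note S = subspace_powspan[of x]
  have Sx: "jp x v \<in> powspan x" if "v \<in> powspan x" for v
    using powspan_jp powspan_self that by blast
  have sa: "inner (jp x u) v = inner u (jp x v)" for u v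
    by (rule inner_jp)
  obtain u w where u: "u \<in> powspan x" "u \<noteq> 0" "jp x u = w *\<^sub>R u"
    and le: "\<And>v. v \<in> powspan x \<Longrightarrow> inner (jp x v) v \<le> w * inner v v"
    using selfadjoint_max_eigenvector[OF linear_jp[of x] S Sx sa powspan_self assms] by blast
  obtain u' w' where u': "u' \<in> powspan x" "u' \<noteq> 0" "- jp x u' = w' *\<^sub>R u'"
    and le': "\<And>v. v \<in> powspan x \<Longrightarrow> inner (- jp x v) v \<le> w' * inner v v"
  proof (rule selfadjoint_max_eigenvector[OF linear_compose_neg[OF linear_jp[of x]] S _ _ powspan_self assms])
    show "- jp x v \<in> powspan x" if "v \<in> powspan x" for v
      using Sx[OF that] S by (simp add: subspace_neg)
    show "inner (- jp x u) v = inner u (- jp x v)" for u v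
      by (simp add: sa)
  qed blast
  have "w \<noteq> 0 \<or> w' \<noteq> 0"
  proof (rule ccontr)
    assume "\<not> (w \<noteq> 0 \<or> w' \<noteq> 0)"
    then have "inner (jp x v) v = 0" if "v \<in> powspan x" for v
      using le[OF that] le'[OF that] by simp
    then have "jp x x = 0"
      using selfadjoint_psd_kernel[OF linear_jp[of x] S Sx sa] powspan_self by simp
    then show False using assms jp_square_eq_0 by blast
  qed
  then show thesis
  proof
    assume "w' \<noteq> 0"
    moreover have "jp x u' = (- w') *\<^sub>R u'" using u'(3) by (metis minus_minus scaleR_minus_left)
    ultimately show thesis using that[of u' "- w'"] u' by simp
  qed (use that u in blast)
qed

text \<open>Every power of \<open>x\<close>, hence every element of \<open>powspan x\<close>,
  multiplies the eigenvector \<open>u\<close> by a scalar. In particular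
  \<open>jp u u = m *\<^sub>R u\<close>, and rescaling by \<open>m\<close> gives an
  idempotent.\<close>

lemma powspan_idempotent:
  assumes "x \<noteq> 0"
  obtains c w where "c \<in> powspan x" "c \<noteq> 0" "jp c c = c" "jp c x = w *\<^sub>R c"
proof -
  obtain u w where u: "u \<in> powspan x" "u \<noteq> 0" and w: "w \<noteq> 0" and xu: "jp x u = w *\<^sub>R u"
    using powspan_nonzero_eigenvector[OF assms] .
  have step: "jp (jpow x (Suc k)) v = jp x (jp (jpow x k) v)" if "v \<in> powspan x" for k v
    using that unfolding powspan_def
  proof (induction rule: span_induct)
    show "subspace {v. jp (jpow x (Suc k)) v = jp x (jp (jpow x k) v)}"
      by (intro subspaceI) (auto simp: jp_simps simp del: jpow.simps)
  next
    fix v assume "v \<in> range (\<lambda>k. jpow x (Suc k))"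
    then obtain j where "v = jpow x (Suc j)" by blast
    then show "jp (jpow x (Suc k)) v = jp x (jp (jpow x k) v)"
      using jp_jpow_jpow[of x "Suc k" "Suc j"] jp_jpow_jpow[of x k "Suc j"] by simp
  qed
  have eig: "jp (jpow x k) u = (w ^ k) *\<^sub>R u" for k
  proof (induction k)
    case (Suc k)
    then show ?case using step[OF u(1), of k] xu by (simp add: jp_simps del: jpow.simps(2))
  qed (simp add: jp_unit_left)
  have "\<exists>m. jp y u = m *\<^sub>R u" if "y \<in> powspan x" for y
    using that unfolding powspan_def
  proof (induction rule: span_induct)
    show "subspace {y. \<exists>m. jp y u = m *\<^sub>R u}"
    proof (intro subspaceI)
      show "0 \<in> {y. \<exists>m. jp y u = m *\<^sub>R u}"
        using jp_simps by (auto intro!: exI[of _ 0])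
    qed (auto simp: jp_simps simp flip: scaleR_add_left)
  qed (use eig in blast)
  then obtain m where m: "jp u u = m *\<^sub>R u" using u by blast
  have "m \<noteq> 0" using m u(2) jp_square_eq_0[of u] by auto
  show thesis
  proof
    show "u /\<^sub>R m \<in> powspan x" using u subspace_powspan by (simp add: subspace_scale)
    show "u /\<^sub>R m \<noteq> 0" using u \<open>m \<noteq> 0\<close> by simp
    show "jp (u /\<^sub>R m) (u /\<^sub>R m) = u /\<^sub>R m" using m \<open>m \<noteq> 0\<close> by (simp add: jp_simps)
    show "jp (u /\<^sub>R m) x = w *\<^sub>R (u /\<^sub>R m)"
      using xu by (simp add: jp_simps jp_commute[of u x])
  qed
qed

definition orthogonal_idempotents :: "'a set \<Rightarrow> bool" where
  "orthogonal_idempotents D \<longleftrightarrow>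
     finite D \<and> (\<forall>d\<in>D. jp d d = d \<and> d \<noteq> 0) \<and> (\<forall>a\<in>D. \<forall>b\<in>D. a \<noteq> b \<longrightarrow> jp a b = 0)"

lemma orthogonal_idempotents_insert:
  assumes "orthogonal_idempotents D" "jp c c = c" "c \<noteq> 0" "\<And>d. d \<in> D \<Longrightarrow> jp c d = 0"
  shows "orthogonal_idempotents (insert c D)"
  using assms unfolding orthogonal_idempotents_def by (metis finite_insert insert_iff jp_commute)

text \<open>Splitting off an idempotent \<open>c\<close> leaves \<open>y\<close> annihilated by
  \<open>c\<close>. All of \<open>powspan y\<close> is then annihilated by \<open>c\<close> and does
  not contain it, so the dimension drops.\<close>

lemma powspan_orthogonal_idempotents:
  "\<exists>D. orthogonal_idempotents D \<and> D \<subseteq> powspan x \<and> x \<in> span D"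
proof (induction "dim (powspan x)" arbitrary: x rule: less_induct)
  case less
  show ?case
  proof (cases "x = 0")
    case True
    then show ?thesis
      by (intro exI[of _ "{}"]) (simp add: orthogonal_idempotents_def)
  next
    case False
    then obtain c w where c: "c \<in> powspan x" "c \<noteq> 0" "jp c c = c" and cx: "jp c x = w *\<^sub>R c"
      using powspan_idempotent by blast
    define y where "y = x - w *\<^sub>R c"
    have "y \<in> powspan x"
      unfolding y_def using c(1) powspan_self subspace_powspan
      by (simp add: subspace_diff subspace_scale)
    then have sub: "powspan y \<subseteq> powspan x"
      by (intro powspan_minimal subspace_powspan powspan_jp)
    have "jp c y = 0"
      by (simp add: y_def jp_simps cx c)
    then have "powspan y \<subseteq> {z. jp c z = 0}"
      using peirce_0_0[OF c(3)] by (intro powspan_minimal subspaceI) (auto simp: jp_simps)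
    then have orth: "jp c z = 0" if "z \<in> powspan y" for z
      using that by blast
    then have "c \<notin> powspan y"
      using c by auto
    then have "powspan y \<subset> powspan x"
      using sub c(1) by blast
    then have "dim (powspan y) < dim (powspan x)"
      using dim_psubset by (metis span_eq_iff subspace_powspan)
    then obtain D where D: "orthogonal_idempotents D" "D \<subseteq> powspan y" "y \<in> span D"
      using less by blast
    have "orthogonal_idempotents (insert c D)"
      using D orth c by (intro orthogonal_idempotents_insert) auto
    moreover have "insert c D \<subseteq> powspan x"
      using D(2) sub c(1) by blast
    moreover have "y + w *\<^sub>R c \<in> span (insert c D)"
      using D(3) span_mono[of D "insert c D"] by (intro span_add span_scale) (auto intro: span_base)
    then have "x \<in> span (insert c D)"
      by (simp add: y_def)
    ultimately show ?thesis by blast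
  qed
qed

lemma inner_eq_0: "jp a b = 0 \<Longrightarrow> inner a b = 0"
  by (metis inner_jp_left inner_zero_left jp_unit jp_commute)

lemma card_orthogonal_idempotents_le:
  assumes "orthogonal_idempotents D"
  shows "card D \<le> DIM('a)"
proof -
  have "pairwise real_inner_class.orthogonal D" "0 \<notin> D"
    using assms inner_eq_0 by (auto simp: pairwise_def real_inner_class.orthogonal_def orthogonal_idempotents_def)
  then show ?thesis
    using pairwise_orthogonal_independent independent_bound by blast
qed

text \<open>The remainder \<open>e - \<Sum>D\<close> is an idempotent annihilated by
  \<open>D\<close>; it is added unless it is 0.\<close>

lemma complete_orthogonal_idempotents:
  "\<exists>D. orthogonal_idempotents D \<and> x \<in> span D \<and> \<Sum>D = e"
proof -
  obtain D where D: "orthogonal_idempotents D" "x \<in> span D"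
    using powspan_orthogonal_idempotents by blast
  define c where "c = e - \<Sum>D"
  have "jp d (\<Sum>D) = d" if "d \<in> D" for d
  proof -
    have "jp d (\<Sum>D) = (\<Sum>a\<in>D. if a = d then d else 0)"
      unfolding jp_sum_right using D(1) that
      by (intro sum.cong) (auto simp: orthogonal_idempotents_def)
    then show ?thesis using D(1) that by (simp add: orthogonal_idempotents_def)
  qed
  then have cd: "jp c d = 0" if "d \<in> D" for d
    using that unfolding jp_commute[of c d] by (simp add: c_def jp_simps jp_unit)
  then have "jp c (\<Sum>D) = 0"
    by (simp add: jp_sum_right)
  then have cc: "jp c c = c"
    by (subst (2) c_def) (simp add: jp_simps jp_unit)
  show ?thesis
  proof (cases "c = 0")
    case True
    then show ?thesis using D by (auto simp: c_def)
  next
    case False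
    then have "c \<notin> D" using cd cc by metis
    then have "\<Sum>(insert c D) = e"
      using D(1) by (simp add: orthogonal_idempotents_def c_def)
    moreover have "orthogonal_idempotents (insert c D)"
      using D cc False cd by (intro orthogonal_idempotents_insert) auto
    moreover have "x \<in> span (insert c D)"
      using D(2) span_mono[of D "insert c D"] by blast
    ultimately show ?thesis by blast
  qed
qed

section \<open>Refinement to primitive idempotents and spectral theorem\<close>

lemma jp_summands_idempotent:
  assumes "jp a a = a" "jp b b = b" "jp (a + b) (a + b) = a + b"
  shows "jp a b = 0"
proof -
  have "2 *\<^sub>R jp a b = 0"
    using assms by (simp add: jp_simps jp_commute[of b a] scaleR_2)
  then show ?thesis by simp
qed

text \<open>A complete system of maximal cardinality consists of primitive idempotents, since a splitting
  of one member would give a larger system.\<close>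

lemma primitive_orthogonal_idempotents:
  "\<exists>D. orthogonal_idempotents D \<and> x \<in> span D \<and> \<Sum>D = e \<and> (\<forall>d\<in>D. primitive_idempotent jp d)"
proof -
  let ?P = "\<lambda>D. orthogonal_idempotents D \<and> x \<in> span D \<and> \<Sum>D = e"
  obtain D0 where "?P D0"
    using complete_orthogonal_idempotents by blast
  moreover have "\<forall>D. ?P D \<longrightarrow> card D < Suc DIM('a)"
    using card_orthogonal_idempotents_le le_imp_less_Suc by blast
  ultimately have "\<exists>D. ?P D \<and> (\<forall>D'. ?P D' \<longrightarrow> card D' \<le> card D)"
    by (rule Lattices_Big.ex_has_greatest_nat)
  then obtain D where D: "?P D" and max: "\<And>D'. ?P D' \<Longrightarrow> card D' \<le> card D"
    by blast
  have fin: "finite D" using D by (simp add: orthogonal_idempotents_def)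
  have "primitive_idempotent jp d" if d: "d \<in> D" for d
  proof (rule ccontr)
    assume "\<not> primitive_idempotent jp d"
    moreover have dd: "jp d d = d" "d \<noteq> 0" using D d by (auto simp: orthogonal_idempotents_def)
    ultimately obtain a b where ab: "jp a a = a" "jp b b = b" "a \<noteq> 0" "b \<noteq> 0" "d = a + b"
      by (auto simp: primitive_idempotent_def idempotent_def)
    have "jp a b = 0"
      using jp_summands_idempotent ab dd by metis
    \<comment> \<open>The inner products of \<open>a\<close> and \<open>b\<close> with
      \<open>d'\<close> are nonnegative and add up to that of \<open>d\<close>, which is 0.\<close>
    have orth: "jp a d' = 0 \<and> jp b d' = 0" if "d' \<in> D - {d}" for d'
    proof -
      have d': "jp d' d' = d'" "jp d d' = 0"
        using that d D by (auto simp: orthogonal_idempotents_def)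
      then have "inner a d' + inner b d' = 0"
        using inner_eq_0 ab(5) by (simp add: inner_add_left[symmetric])
      then have "inner a d' = 0" "inner b d' = 0"
        using inner_idempotents_nonneg[OF ab(1) d'(1)] inner_idempotents_nonneg[OF ab(2) d'(1)]
        by linarith+
      then show ?thesis using jp_idempotents_eq_0 ab d' by blast
    qed
    have nin: "a \<notin> D - {d}" "b \<notin> D - {d}" "a \<noteq> b"
      using orth ab \<open>jp a b = 0\<close> by metis+
    let ?D = "insert a (insert b (D - {d}))"
    have "orthogonal_idempotents (D - {d})"
      using D by (simp add: orthogonal_idempotents_def)
    then have "orthogonal_idempotents ?D"
      using orth ab \<open>jp a b = 0\<close> by (intro orthogonal_idempotents_insert) auto
    moreover have "\<Sum>?D = e"
      using nin fin D ab(5) sum.remove[OF fin d, of "\<lambda>x. x"] by (simp add: add.assoc)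
    moreover have "D \<subseteq> span ?D"
    proof
      fix z assume "z \<in> D"
      moreover have "a + b \<in> span ?D"
        by (intro span_add) (auto intro: span_base)
      ultimately show "z \<in> span ?D"
        using ab(5) by (cases "z = d") (auto intro: span_base)
    qed
    then have "x \<in> span ?D"
      using D span_minimal[of D "span ?D"] by auto
    ultimately have "card ?D \<le> card D" using max by blast
    moreover have "card ?D = Suc (card D)"
      using nin fin d by (simp add: card_Diff_singleton card_gt_0_iff) (metis card_gt_0_iff emptyE Suc_pred)
    ultimately show False by simp
  qed
  then show ?thesis using D by blast
qed

theorem spectral_decomposition_exists:
  "\<exists>ws c. sorted_wrt (\<ge>) ws \<and> spectral_decomposition jp e x ws c"
proof -
  obtain D where D: "orthogonal_idempotents D" "x \<in> span D" "\<Sum>D = e"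
    "\<forall>d\<in>D. primitive_idempotent jp d"
    using primitive_orthogonal_idempotents by blast
  have fin: "finite D" using D by (simp add: orthogonal_idempotents_def)
  then obtain w where w: "x = (\<Sum>d\<in>D. w d *\<^sub>R d)"
    using D(2) by (auto simp: span_finite)
  obtain l where l: "set l = D" "distinct l"
    using finite_distinct_list[OF fin] by blast
  \<comment> \<open>Sorting by the negated coefficients makes the eigenvalue list
    decreasing.\<close>
  define ds where "ds = sort_key (\<lambda>d. - w d) l"
  have ds: "set ds = D" "distinct ds"
    using l by (simp_all add: ds_def)
  have sum: "(\<Sum>i<length ds. f (ds ! i)) = (\<Sum>d\<in>D. f d)" for f :: "'a \<Rightarrow> 'a"
    using ds sum.reindex_bij_betw[OF bij_betw_nth[OF ds(2) refl refl], of f] by simp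
  have "sorted (map (\<lambda>d. - w d) ds)"
    by (simp add: ds_def)
  then have "sorted_wrt (\<ge>) (map w ds)"
    by (simp add: sorted_wrt_map)
  moreover have "spectral_decomposition jp e x (map w ds) (\<lambda>i. ds ! i)"
    unfolding spectral_decomposition_def jordan_frame_def
  proof (intro conjI allI impI)
    show "(\<Sum>i<length (map w ds). ds ! i) = e"
      using sum[of "\<lambda>x. x"] D by simp
    show "x = (\<Sum>i<length (map w ds). (map w ds ! i) *\<^sub>R ds ! i)"
      using sum[of "\<lambda>d. w d *\<^sub>R d"] w by simp
  next
    fix i j assume "i < length (map w ds)" "j < length (map w ds)" "i \<noteq> j"
    then show "jp (ds ! i) (ds ! j) = 0"
      using D(1) ds nth_eq_iff_index_eq[OF ds(2)] nth_mem
      unfolding orthogonal_idempotents_def by (metis length_map)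
  qed (use D ds in auto)
  ultimately show ?thesis by blast
qed

end

section \<open>Schur products\<close>

text \<open>Elimination of the last index by a Schur complement; if the pivot \<open>a n n\<close> is \<open>0\<close>, so is its row,
  and the convention \<open>x / 0 = 0\<close> makes the same formulas work.\<close>

lemma psd_gram:
  fixes a :: "nat \<Rightarrow> nat \<Rightarrow> real"
  assumes "\<And>i j. i < n \<Longrightarrow> j < n \<Longrightarrow> a i j = a j i"
    and "\<And>x. 0 \<le> (\<Sum>i<n. \<Sum>j<n. x i * a i j * x j)"
  shows "\<exists>v. \<forall>i<n. \<forall>j<n. a i j = (\<Sum>k<n. v k i * v k j)"
  using assms
proof (induction n arbitrary: a)
  case 0
  then show ?case by simp
next
  case (Suc n)
  let ?Q = "\<lambda>x. \<Sum>i<n. \<Sum>j<n. x i * a i j * x j"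
  let ?L = "\<lambda>x. \<Sum>i<n. x i * a i n"
  let ?p = "a n n"
  have sym: "a n i = a i n" if "i < n" for i
    using Suc.prems(1)[of n i] that by simp
  \<comment> \<open>The form of size \<open>Suc n\<close> at \<open>x\<close> extended by the entry
    \<open>s\<close>, as a quadratic in \<open>s\<close>; its minimum at \<open>- ?L x / ?p\<close>
    is the Schur complement.\<close>
  have ext: "0 \<le> ?Q x + 2 * s * ?L x + ?p * s\<^sup>2" for x s
  proof -
    let ?y = "\<lambda>i. if i = n then s else x i"
    have "(\<Sum>i<Suc n. \<Sum>j<Suc n. ?y i * a i j * ?y j)
      = (\<Sum>i<n. (\<Sum>j<n. x i * a i j * x j) + x i * a i n * s) + ((\<Sum>j<n. s * a n j * x j) + s * a n n * s)"
      by simp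
    also have "\<dots> = ?Q x + 2 * s * ?L x + ?p * s\<^sup>2"
      by (simp add: sum.distrib sum_distrib_left sym power2_eq_square algebra_simps)
    finally show ?thesis
      using Suc.prems(2)[of ?y] by simp
  qed
  have p: "0 \<le> ?p"
    using ext[of "\<lambda>_. 0" 1] by simp
  have zero: "a i n = 0" if "?p = 0" "i < n" for i
  proof -
    let ?x = "\<lambda>j. if j = i then 1 else 0 :: real"
    have L: "?L ?x = a i n"
      using that by (simp add: if_distrib[of "\<lambda>t. t * _"] cong: if_cong)
    define q where "q = ?Q ?x"
    have "0 \<le> q + 2 * s * a i n" for s
      using ext[of ?x s] that(1) unfolding L q_def by simp
    \<comment> \<open>For nonzero \<open>a i n\<close> this choice of \<open>s\<close> would make
      the bound equal to -1.\<close>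
    from this[of "- (q + 1) / (2 * a i n)"] show ?thesis
      by (cases "a i n = 0") (auto simp: field_simps)
  qed
  let ?b = "\<lambda>i j. a i j - a i n * a j n / ?p"
  have "\<exists>v. \<forall>i<n. \<forall>j<n. ?b i j = (\<Sum>k<n. v k i * v k j)"
  proof (rule Suc.IH)
    show "?b i j = ?b j i" if "i < n" "j < n" for i j
      using Suc.prems(1)[of i j] that by simp
    show "0 \<le> (\<Sum>i<n. \<Sum>j<n. x i * ?b i j * x j)" for x
    proof -
      have "(\<Sum>i<n. \<Sum>j<n. x i * ?b i j * x j) = ?Q x - (\<Sum>i<n. \<Sum>j<n. (x i * a i n) * (x j * a j n)) / ?p"
        by (simp add: sum_subtractf[symmetric] sum_divide_distrib algebra_simps)
      also have "\<dots> = ?Q x - (?L x)\<^sup>2 / ?p"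
        by (simp add: power2_eq_square sum_product)
      also have "\<dots> = ?Q x + 2 * (- ?L x / ?p) * ?L x + ?p * (- ?L x / ?p)\<^sup>2"
        by (cases "?p = 0") (simp_all add: power2_eq_square)
      finally show ?thesis
        using ext[of x "- ?L x / ?p"] by linarith
    qed
  qed
  then obtain v where v: "\<And>i j. i < n \<Longrightarrow> j < n \<Longrightarrow> ?b i j = (\<Sum>k<n. v k i * v k j)"
    by blast
  \<comment> \<open>The new vector is the last column over the root of the pivot; the old ones are
    extended by 0 at index \<open>n\<close>.\<close>
  let ?w = "\<lambda>k i. if k < n then if i < n then v k i else 0 else a i n / sqrt ?p"
  have "a i j = (\<Sum>k<Suc n. ?w k i * ?w k j)" if "i < Suc n" "j < Suc n" for i j
  proof -
    have "(\<Sum>k<Suc n. ?w k i * ?w k j)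
      = (if i < n \<and> j < n then \<Sum>k<n. v k i * v k j else 0) + a i n * a j n / ?p"
      using p by (cases "i < n"; cases "j < n") simp_all
    also have "\<dots> = a i j"
      using that v[of i j] zero[of i] zero[of j] sym[of j] by (auto simp: less_Suc_eq)
    finally show ?thesis by simp
  qed
  then show ?case by (intro exI[of _ ?w]) blast
qed

section \<open>Primitive idempotents and the quadratic representation\<close>

context euclidean_jordan_algebra
begin

lemma primitive_idempotentD:
  assumes "primitive_idempotent jp f"
  shows "jp f f = f" "f \<noteq> 0"
  using assms by (auto simp: primitive_idempotent_def idempotent_def)

lemma primitive_idempotent_eq:
  assumes "primitive_idempotent jp f" "jp d d = d" "d \<noteq> 0" "jp f d = d"
  shows "d = f"
proof (rule ccontr)
  assume "d \<noteq> f"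
  moreover have "jp (f - d) (f - d) = f - d"
    using primitive_idempotentD[OF assms(1)] assms by (simp add: jp_simps jp_commute[of d f])
  moreover have "f = d + (f - d)"
    by simp
  ultimately show False
    using assms unfolding primitive_idempotent_def idempotent_def by (metis eq_iff_diff_eq_0)
qed

text \<open>The 1-space of \<open>f\<close> is a subalgebra, so it contains the idempotents that
  span \<open>x\<close>; primitivity leaves only \<open>f\<close> itself among them.\<close>

lemma peirce_1_primitive:
  assumes f: "primitive_idempotent jp f" and x: "jp f x = x"
  obtains a where "x = a *\<^sub>R f"
proof -
  obtain D where D: "orthogonal_idempotents D" "D \<subseteq> powspan x" "x \<in> span D"
    using powspan_orthogonal_idempotents by blast
  have "powspan x \<subseteq> {z. jp f z = z}"
    using peirce_1_1[OF primitive_idempotentD(1)[OF f]] x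
    by (intro powspan_minimal subspaceI) (auto simp: jp_simps)
  then have "D \<subseteq> {f}"
    using D primitive_idempotent_eq[OF f] unfolding orthogonal_idempotents_def by blast
  then have "x \<in> span {f}"
    using D(3) span_mono by blast
  then show thesis
    using that by (auto simp: span_singleton)
qed

text \<open>For symmetric matrices with the symmetrized product this is the map taking x to the
  matrix product d x d.\<close>

definition quadratic_rep :: "'a \<Rightarrow> 'a \<Rightarrow> 'a" where
  "quadratic_rep d x = 2 *\<^sub>R jp d (jp d x) - jp (jp d d) x"

text \<open>Write \<open>d = \<alpha> f + h + k\<close> for the Peirce decomposition relative to \<open>f\<close>. Since \<open>f\<close> is primitive,
  \<open>h\<^sup>2 = \<beta> f + h0\<close> with \<open>f h0 = 0\<close>, and the Jordan identity gives \<open>h\<^sup>3 = \<beta> h\<close> and \<open>h0\<^sup>2 = \<beta> h0\<close>. Hence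
  \<open>\<alpha>\<^sup>2 f + \<alpha> h + h0\<close>, the image of \<open>f\<close>, is \<open>\<alpha>\<^sup>2 + \<beta>\<close> times an idempotent.\<close>

lemma quadratic_rep_primitive:
  assumes f: "primitive_idempotent jp f"
  obtains s where "0 \<le> s"
    "jp (quadratic_rep d f) (quadratic_rep d f) = s *\<^sub>R quadratic_rep d f"
proof -
  note ff = primitive_idempotentD(1)[OF f]
  obtain d1 h k where d: "d = d1 + h + k"
    and d1: "jp f d1 = d1" and fh: "jp f h = (1/2) *\<^sub>R h" and fk: "jp f k = 0"
    using peirce_decompose[OF ff] by metis
  obtain \<alpha> where \<alpha>: "d1 = \<alpha> *\<^sub>R f"
    using peirce_1_primitive[OF f d1] .
  obtain \<beta> where \<beta>: "jp f (jp h h) = \<beta> *\<^sub>R f"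
    using peirce_1_primitive[OF f peirce_half_half[OF ff fh]] .
  have fhk: "jp f (jp h k) = (1/2) *\<^sub>R jp h k"
    using peirce_0_half[OF ff fk fh] by (simp add: jp_commute[of h k])
  have fkk: "jp f (jp k k) = 0"
    using peirce_0_0[OF ff fk fk] .
  \<comment> \<open>In the Jordan identity for \<open>h\<close> and \<open>f\<close>, the left side
    is \<open>h\<close> times \<open>\<beta> *\<^sub>R f\<close> and the right side is half the cube
    of \<open>h\<close>.\<close>
  have hhh: "jp h (jp h h) = \<beta> *\<^sub>R h"
  proof -
    have "(\<beta> / 2) *\<^sub>R h = (1/2) *\<^sub>R jp h (jp h h)"
      using jordan_identity[of h f]
      unfolding jp_commute[of "jp h h" f] jp_commute[of h f] \<beta> fh jp_simps jp_commute[of "jp h h" h]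
      by (simp add: jp_commute[of h f] fh)
    then have "2 *\<^sub>R (\<beta> / 2) *\<^sub>R h = 2 *\<^sub>R (1/2) *\<^sub>R jp h (jp h h)"
      by (rule arg_cong)
    then show ?thesis by simp
  qed
  define h0 where "h0 = jp h h - \<beta> *\<^sub>R f"
  have hh: "jp h h = \<beta> *\<^sub>R f + h0"
    by (simp add: h0_def)
  have fh0: "jp f h0 = 0"
    by (simp add: h0_def jp_simps \<beta> ff)
  have hf: "jp h f = (1/2) *\<^sub>R h" "jp k f = 0" "jp h0 f = 0"
    using fh fk fh0 by (simp_all add: jp_commute[of _ f])
  have pf: "jp (jp h h) f = \<beta> *\<^sub>R f" "jp (jp k k) f = 0" "jp (jp h k) f = (1/2) *\<^sub>R jp h k"
    using \<beta> fkk fhk by (simp_all add: jp_commute[of _ f])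
  have hh0: "jp h h0 = (\<beta> / 2) *\<^sub>R h"
    by (simp add: h0_def jp_simps hhh hf scaleR_diff_left[symmetric])
  have h0h: "jp h0 h = (\<beta> / 2) *\<^sub>R h"
    using hh0 by (simp add: jp_commute[of h0 h])
  have h0h0: "jp h0 h0 = \<beta> *\<^sub>R h0"
  proof -
    have "jp (jp h h) (jp h h) = jp h (jp h (jp h h))"
      using jordan_identity[of h h] by (simp add: jp_commute[of "jp h h" h])
    also have "\<dots> = \<beta> *\<^sub>R jp h h"
      by (simp add: hhh jp_simps)
    finally show ?thesis
      by (simp add: hh jp_simps ff fh0 hf algebra_simps)
  qed
  have q: "quadratic_rep d f = \<alpha>\<^sup>2 *\<^sub>R f + \<alpha> *\<^sub>R h + h0"
  proof (rule inner_eqI)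
    fix w
    show "inner (quadratic_rep d f) w = inner (\<alpha>\<^sup>2 *\<^sub>R f + \<alpha> *\<^sub>R h + h0) w"
      unfolding quadratic_rep_def d \<alpha>
      by (simp add: jp_simps ff fh fk hf pf jp_commute[of k h] h0_def inner_simps
          power2_eq_square algebra_simps)
  qed
  \<comment> \<open>Pairing the equation for \<open>\<beta>\<close> with \<open>f\<close> shows
    \<open>\<beta>\<close> to be a ratio of squared norms.\<close>
  have "\<beta> * inner f f = inner (jp f (jp h h)) f"
    by (simp add: \<beta>)
  also have "\<dots> = inner h h / 2"
    by (simp add: inner_jp ff inner_jp_left hf)
  finally have "\<beta> = inner h h / (2 * inner f f)"
    using primitive_idempotentD(2)[OF f] by (simp add: field_simps)
  then have "0 \<le> \<beta>"
    by simp
  moreover have "jp (quadratic_rep d f) (quadratic_rep d f) = (\<alpha>\<^sup>2 + \<beta>) *\<^sub>R quadratic_rep d f"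
  proof (rule inner_eqI)
    fix w
    show "inner (jp (quadratic_rep d f) (quadratic_rep d f)) w
      = inner ((\<alpha>\<^sup>2 + \<beta>) *\<^sub>R quadratic_rep d f) w"
      unfolding q
      by (simp add: jp_simps ff fh fh0 hf hh hh0 h0h h0h0 inner_simps power2_eq_square algebra_simps)
  qed
  ultimately show thesis
    using that by (metis add_nonneg_nonneg zero_le_power2)
qed

text \<open>For the image \<open>u\<close>, self-adjointness gives
  \<open>s * inner u g = inner (jp g u) u\<close>, which is nonnegative; if \<open>s = 0\<close>,
  then \<open>u = 0\<close>.\<close>

lemma inner_quadratic_rep_nonneg:
  assumes f: "primitive_idempotent jp f" and g: "jp g g = g"
  shows "0 \<le> inner (quadratic_rep d f) g"
proof -
  let ?u = "quadratic_rep d f"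
  obtain s where s: "0 \<le> s" "jp ?u ?u = s *\<^sub>R ?u"
    using quadratic_rep_primitive[OF f] .
  show ?thesis
  proof (cases "s = 0")
    case True
    then show ?thesis using s jp_square_eq_0[of ?u] by simp
  next
    case False
    have "s * inner ?u g = inner (jp g ?u) ?u"
      using s(2) inner_jp_left[of ?u ?u g] by (simp add: jp_commute[of ?u g] inner_commute)
    then have "0 \<le> s * inner ?u g"
      using inner_idempotent(1)[OF g] by simp
    then show ?thesis
      using s(1) False by (simp add: zero_le_mult_iff)
  qed
qed

end

text \<open>Each off-diagonal pair occurs twice in the full square, hence 4 against 2. This turns
  the sum of Peirce components over \<open>i \<le> j\<close> into the double sum of
  \<open>schur_map\<close>.\<close>

lemma sum_triangle:
  fixes G :: "nat \<Rightarrow> nat \<Rightarrow> 'a::real_vector"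
  assumes "\<And>i j. i < n \<Longrightarrow> j < n \<Longrightarrow> G i j = G j i"
  shows "(\<Sum>j<n. \<Sum>i\<le>j. if i = j then 2 *\<^sub>R G i i - D i else 4 *\<^sub>R G i j)
    = 2 *\<^sub>R (\<Sum>i<n. \<Sum>j<n. G i j) - (\<Sum>i<n. D i)"
  using assms
proof (induction n)
  case (Suc n)
  have "(\<Sum>j<n. G n j) = (\<Sum>i<n. G i n)"
    using Suc.prems by (intro sum.cong) auto
  moreover have "(\<Sum>i\<le>n. if i = n then 2 *\<^sub>R G i i - D i else 4 *\<^sub>R G i n)
    = 2 *\<^sub>R (\<Sum>i<n. G i n) + 2 *\<^sub>R (\<Sum>i<n. G i n) + 2 *\<^sub>R G n n - D n"
  proof -
    have "(4::real) *\<^sub>R x = 2 *\<^sub>R x + 2 *\<^sub>R x" for x :: 'a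
      by (simp flip: scaleR_add_left)
    then show ?thesis
      by (simp add: lessThan_Suc_atMost[symmetric] scaleR_sum_right sum.distrib)
  qed
  moreover have "(\<Sum>j<n. \<Sum>i\<le>j. if i = j then 2 *\<^sub>R G i i - D i else 4 *\<^sub>R G i j)
    = 2 *\<^sub>R (\<Sum>i<n. \<Sum>j<n. G i j) - (\<Sum>i<n. D i)"
    using Suc by simp
  ultimately show ?case
    by (simp add: sum.distrib scaleR_add_right del: sum.atMost_Suc)
qed simp

section \<open>The Schur product as a linear map\<close>

locale jordan_frame_algebra = euclidean_jordan_algebra +
  fixes n :: nat and c :: "nat \<Rightarrow> 'a"
  assumes frame: "jordan_frame jp e n c"
begin

lemma frame_primitive: "i < n \<Longrightarrow> primitive_idempotent jp (c i)"
  and frame_orthogonal: "i < n \<Longrightarrow> j < n \<Longrightarrow> i \<noteq> j \<Longrightarrow> jp (c i) (c j) = 0"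
  and frame_sum: "(\<Sum>i<n. c i) = e"
  using frame by (auto simp: jordan_frame_def)

lemma frame_idempotent: "i < n \<Longrightarrow> jp (c i) (c i) = c i"
  and frame_nonzero: "i < n \<Longrightarrow> c i \<noteq> 0"
  using frame_primitive primitive_idempotentD by blast+

lemma frame_jp: "i < n \<Longrightarrow> j < n \<Longrightarrow> jp (c i) (c j) = (if i = j then c i else 0)"
  by (simp add: frame_idempotent frame_orthogonal)

lemma frame_jp_commute:
  assumes "i < n" "j < n"
  shows "jp (c i) (jp (c j) x) = jp (c j) (jp (c i) x)"
  using jp_orthogonal_idempotents(1)[of "c i" "c j" x] assms
  by (cases "i = j") (simp_all add: frame_jp)

lemma frame_jp_sum: "i < n \<Longrightarrow> jp (c i) (\<Sum>j<n. w j *\<^sub>R c j) = w i *\<^sub>R c i"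
  by (simp add: jp_sum_right jp_simps frame_jp if_distrib[of "scaleR _"] cong: if_cong)

text \<open>The quadratic representation of the sum of \<open>v i *\<^sub>R c i\<close>, with
  \<open>v i * v j\<close> replaced by \<open>a i j\<close>. It is linear in \<open>a\<close>, and
  for symmetric \<open>a\<close> it is the Schur product.\<close>

definition schur_map :: "(nat \<Rightarrow> nat \<Rightarrow> real) \<Rightarrow> 'a \<Rightarrow> 'a" where
  "schur_map a x = 2 *\<^sub>R (\<Sum>i<n. \<Sum>j<n. a i j *\<^sub>R jp (c i) (jp (c j) x)) - (\<Sum>i<n. a i i *\<^sub>R jp (c i) x)"

lemma linear_schur_map: "linear (schur_map a)"
  unfolding schur_map_def[abs_def]
  by (intro linear_compose_sub linear_compose_scale_right linear_compose_sum ballI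
      linear_compose[OF linear_jp linear_jp, unfolded o_def] linear_jp)

lemma schur_map_cong:
  "(\<And>i j. i < n \<Longrightarrow> j < n \<Longrightarrow> a i j = a' i j) \<Longrightarrow> schur_map a x = schur_map a' x"
  by (simp add: schur_map_def)

lemma schur_map_sum_left: "schur_map (\<lambda>i j. \<Sum>k\<in>K. a k i j) x = (\<Sum>k\<in>K. schur_map (a k) x)"
proof -
  have "(\<Sum>i<n. \<Sum>j<n. \<Sum>k\<in>K. a k i j *\<^sub>R jp (c i) (jp (c j) x))
    = (\<Sum>k\<in>K. \<Sum>i<n. \<Sum>j<n. a k i j *\<^sub>R jp (c i) (jp (c j) x))"
    by (simp add: sum.swap[of _ _ K])
  moreover have "(\<Sum>i<n. \<Sum>k\<in>K. a k i i *\<^sub>R jp (c i) x) = (\<Sum>k\<in>K. \<Sum>i<n. a k i i *\<^sub>R jp (c i) x)"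
    by (rule sum.swap)
  ultimately show ?thesis
    by (simp add: schur_map_def scaleR_sum_left sum_subtractf scaleR_sum_right)
qed

lemma inner_schur_map: "inner (schur_map a x) y = inner x (schur_map a y)"
proof -
  have "inner (jp (c i) (jp (c j) x)) y = inner x (jp (c i) (jp (c j) y))" if "i < n" "j < n" for i j
    using frame_jp_commute[OF that] by (simp add: inner_jp)
  then show ?thesis
    by (simp add: schur_map_def inner_diff_left inner_diff_right inner_sum_left inner_sum_right inner_jp)
qed

lemma schur_map_unit: "schur_map a e = (\<Sum>i<n. a i i *\<^sub>R c i)"
proof -
  have "(\<Sum>i<n. \<Sum>j<n. a i j *\<^sub>R jp (c i) (c j)) = (\<Sum>i<n. a i i *\<^sub>R c i)"
    by (intro sum.cong refl) (simp add: frame_jp if_distrib[of "scaleR _"] cong: if_cong)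
  then show ?thesis
    by (simp add: schur_map_def jp_unit scaleR_2)
qed

lemma schur_map_rank1:
  "schur_map (\<lambda>i j. v i * v j) x = quadratic_rep (\<Sum>i<n. v i *\<^sub>R c i) x"
proof -
  let ?d = "\<Sum>i<n. v i *\<^sub>R c i"
  have d: "jp ?d x = (\<Sum>i<n. v i *\<^sub>R jp (c i) x)" for x
    by (simp add: jp_sum_left jp_simps)
  have dd: "jp ?d ?d = (\<Sum>i<n. (v i * v i) *\<^sub>R c i)"
    unfolding d by (simp add: frame_jp_sum)
  have "jp ?d (jp ?d x) = (\<Sum>i<n. \<Sum>j<n. (v i * v j) *\<^sub>R jp (c i) (jp (c j) x))"
    unfolding d by (simp add: jp_sum_right jp_simps scaleR_sum_right)
  moreover have "jp (jp ?d ?d) x = (\<Sum>i<n. (v i * v i) *\<^sub>R jp (c i) x)"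
    unfolding dd by (simp add: jp_sum_left jp_simps)
  ultimately show ?thesis
    by (simp add: schur_map_def quadratic_rep_def)
qed

lemma schur_map_1: "schur_map (\<lambda>_ _. 1) x = x"
  using schur_map_rank1[of "\<lambda>_. 1" x]
  by (simp add: frame_sum quadratic_rep_def jp_unit_left scaleR_2)

lemma inner_schur_map_nonneg:
  assumes "\<And>i j. i < n \<Longrightarrow> j < n \<Longrightarrow> a i j = a j i"
    and "\<And>x. 0 \<le> (\<Sum>i<n. \<Sum>j<n. x i * a i j * x j)"
    and "primitive_idempotent jp f" "jp g g = g"
  shows "0 \<le> inner (schur_map a f) g"
proof -
  obtain v where v: "\<And>i j. i < n \<Longrightarrow> j < n \<Longrightarrow> a i j = (\<Sum>k<n. v k i * v k j)"
    using psd_gram[of n a] assms(1,2) by blast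
  have "schur_map a f = schur_map (\<lambda>i j. \<Sum>k<n. v k i * v k j) f"
    by (rule schur_map_cong) (rule v)
  also have "\<dots> = (\<Sum>k<n. quadratic_rep (\<Sum>i<n. v k i *\<^sub>R c i) f)"
    by (simp add: schur_map_sum_left schur_map_rank1)
  finally show ?thesis
    using inner_quadratic_rep_nonneg[OF assms(3,4)] by (simp add: inner_sum_left sum_nonneg)
qed

text \<open>The diagonal case is the projection onto the 1-space from
  \<open>peirce_decompose\<close>. Off the diagonal, \<open>c i\<close> and \<open>c j\<close> both
  act as 1/2 on the target space, which explains the factor 4.\<close>

definition peirce_component :: "nat \<Rightarrow> nat \<Rightarrow> 'a \<Rightarrow> 'a" where
  "peirce_component i j x =
     (if i = j then 2 *\<^sub>R jp (c i) (jp (c i) x) - jp (c i) x else 4 *\<^sub>R jp (c i) (jp (c j) x))"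

text \<open>With all entries 1 this is the Peirce decomposition of \<open>x\<close>, by
  \<open>schur_map_1\<close>.\<close>

lemma sum_peirce_component:
  assumes "\<And>i j. i < n \<Longrightarrow> j < n \<Longrightarrow> a i j = a j i"
  shows "(\<Sum>j<n. \<Sum>i\<le>j. a i j *\<^sub>R peirce_component i j x) = schur_map a x"
proof -
  have "(\<Sum>j<n. \<Sum>i\<le>j. a i j *\<^sub>R peirce_component i j x)
    = (\<Sum>j<n. \<Sum>i\<le>j. if i = j then 2 *\<^sub>R (a i i *\<^sub>R jp (c i) (jp (c i) x)) - a i i *\<^sub>R jp (c i) x
         else 4 *\<^sub>R (a i j *\<^sub>R jp (c i) (jp (c j) x)))"
    by (intro sum.cong refl) (simp add: peirce_component_def algebra_simps)
  also have "\<dots> = schur_map a x"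
    unfolding schur_map_def
    by (rule sum_triangle) (simp add: assms frame_jp_commute)
  finally show ?thesis .
qed

lemma peirce_component_mem:
  assumes "i < n" "j < n"
  shows "peirce_component i j x \<in> peirce_space jp c i j"
proof (cases "i = j")
  case True
  have "jp (c i) (peirce_component i i x) = peirce_component i i x"
  proof (rule inner_eqI)
    fix w
    show "inner (jp (c i) (peirce_component i i x)) w = inner (peirce_component i i x) w"
      using idempotent_cubic[OF frame_idempotent[OF assms(1)], of x, THEN inner_cong_left, of w]
      by (simp add: peirce_component_def jp_simps inner_simps)
  qed
  then obtain t where "peirce_component i i x = t *\<^sub>R c i"
    using peirce_1_primitive[OF frame_primitive[OF assms(1)]] by blast
  then show ?thesis
    using True by (simp add: peirce_space_def span_base span_scale)
next
  case False
  let ?z = "jp (c i) (jp (c j) x)"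
  have "2 *\<^sub>R jp (c i) ?z = ?z" "2 *\<^sub>R jp (c j) ?z = ?z"
    using jp_orthogonal_idempotents(2)[of "c i" "c j" x] jp_orthogonal_idempotents(2)[of "c j" "c i" x]
      assms False by (auto simp: frame_jp frame_jp_commute[of i j])
  then have "jp (c i) ?z = (1/2) *\<^sub>R ?z" "jp (c j) ?z = (1/2) *\<^sub>R ?z"
    by (metis (no_types, lifting) scaleR_half_double scaleR_2)+
  then show ?thesis
    using False by (simp add: peirce_component_def peirce_space_def jp_simps jp_commute[of _ "c i"]
        jp_commute[of _ "c j"])
qed

lemma peirce_space_eigenvalues:
  assumes "i < n" "j < n" "k < n" and p: "p \<in> peirce_space jp c i j"
  shows "jp (c k) p = ((if k = i then 1/2 else 0) + (if k = j then 1/2 else 0)) *\<^sub>R p"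
proof (cases "i = j")
  case True
  then obtain t where "p = t *\<^sub>R c i"
    using p by (auto simp: peirce_space_def span_singleton)
  then show ?thesis
    using assms True by (simp add: jp_simps frame_jp)
next
  case False
  have ij: "jp (c i) p = (1/2) *\<^sub>R p" "jp (c j) p = (1/2) *\<^sub>R p"
    using p False by (simp_all add: peirce_space_def jp_commute[of p])
  show ?thesis
  proof (cases "k = i \<or> k = j")
    case True
    then show ?thesis using ij False by auto
  next
    case k: False
    \<comment> \<open>For a third index \<open>k\<close>, the idempotent \<open>c i + c j\<close>
      fixes \<open>p\<close> and annihilates \<open>c k\<close>, so \<open>peirce_1_0\<close>
      applies.\<close>
    have 1: "jp (c i + c j) p = p"
      by (simp add: jp_simps ij flip: scaleR_add_left)
    have "jp (c k) (c i + c j) = 0" "jp (c i + c j) (c i + c j) = c i + c j"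
      using assms False k by (simp_all add: jp_simps frame_jp)
    then have "2 *\<^sub>R jp (c k) p = jp (c k) p"
      using peirce_1_0[of "c i + c j" p "c k"] 1 by (simp add: jp_commute[of _ "c k"])
    then show ?thesis
      using k by (simp add: scaleR_2)
  qed
qed

text \<open>Each \<open>c k\<close> acts on \<open>p\<close> by the weight \<open>m k\<close>, 1/2
  for each of \<open>i\<close>, \<open>j\<close> equal to \<open>k\<close>. The double sum
  contributes (a_ii + 2 a_ij + a_jj)/2, and the single sum removes the diagonal entries.\<close>

lemma schur_map_peirce_space:
  assumes "\<And>i j. i < n \<Longrightarrow> j < n \<Longrightarrow> a i j = a j i"
    and "i < n" "j < n" and p: "p \<in> peirce_space jp c i j"
  shows "schur_map a p = a i j *\<^sub>R p"
proof -
  define m where "m k = (if k = i then 1/2 else 0) + (if k = j then 1/2 else 0 :: real)" for k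
  have m: "jp (c k) p = m k *\<^sub>R p" if "k < n" for k
    using peirce_space_eigenvalues[OF assms(2,3) that p] by (simp add: m_def)
  have m_sum: "(\<Sum>k<n. t k * m k) = (t i + t j) / 2" for t
    using assms(2,3)
    by (simp add: m_def distrib_left sum.distrib if_distrib[of "\<lambda>u. _ * u"] add_divide_distrib cong: if_cong)
  have "schur_map a p = 2 *\<^sub>R (\<Sum>k<n. ((\<Sum>l<n. a k l * m l) * m k) *\<^sub>R p) - (\<Sum>k<n. (a k k * m k) *\<^sub>R p)"
    by (simp add: schur_map_def m jp_simps scaleR_sum_left sum_distrib_right mult.assoc
        mult.commute[of "m _" "m _"])
  also have "\<dots> = (2 * (\<Sum>k<n. (\<Sum>l<n. a k l * m l) * m k) - (\<Sum>k<n. a k k * m k)) *\<^sub>R p"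
    by (simp add: scaleR_sum_left[symmetric] scaleR_diff_left)
  also have "2 * (\<Sum>k<n. (\<Sum>l<n. a k l * m l) * m k) - (\<Sum>k<n. a k k * m k) = a i j"
    unfolding m_sum using assms(1)[of i j] assms(2,3) by (simp add: field_simps)
  finally show ?thesis .
qed

text \<open>The explicit components provide a decomposition. Any other one gives the same result,
  since \<open>schur_map\<close> scales each of its parts by the matrix entry.\<close>

lemma schur_product_eq:
  assumes sym: "\<And>i j. i < n \<Longrightarrow> j < n \<Longrightarrow> A $$ (i, j) = A $$ (j, i)"
  shows "schur_product jp n c A x = schur_map (\<lambda>i j. A $$ (i, j)) x"
  unfolding schur_product_def
proof (rule the_equality)
  have "peirce_decomposition jp n c x (\<lambda>i j. peirce_component i j x)"
    using peirce_component_mem sum_peirce_component[of "\<lambda>_ _. 1" x] schur_map_1[of x]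
    by (auto simp: peirce_decomposition_def)
  then show "\<exists>p. peirce_decomposition jp n c x p \<and>
      schur_map (\<lambda>i j. A $$ (i, j)) x = (\<Sum>j<n. \<Sum>i\<le>j. A $$ (i, j) *\<^sub>R p i j)"
    using sum_peirce_component[of "\<lambda>i j. A $$ (i, j)" x, OF sym]
    by (intro exI[of _ "\<lambda>i j. peirce_component i j x"] conjI) simp_all
next
  fix y
  assume "\<exists>p. peirce_decomposition jp n c x p \<and> y = (\<Sum>j<n. \<Sum>i\<le>j. A $$ (i, j) *\<^sub>R p i j)"
  then obtain p where p: "\<And>i j. j < n \<Longrightarrow> i \<le> j \<Longrightarrow> p i j \<in> peirce_space jp c i j"
    and x: "x = (\<Sum>j<n. \<Sum>i\<le>j. p i j)" and y: "y = (\<Sum>j<n. \<Sum>i\<le>j. A $$ (i, j) *\<^sub>R p i j)"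
    by (auto simp: peirce_decomposition_def)
  let ?a = "\<lambda>i j. A $$ (i, j)"
  have "schur_map ?a x = (\<Sum>j<n. \<Sum>i\<le>j. schur_map ?a (p i j))"
    by (simp add: x linear_sum[OF linear_schur_map])
  also have "\<dots> = y"
    unfolding y using p by (intro sum.cong refl schur_map_peirce_space sym) auto
  finally show "y = schur_map ?a x" by simp
qed

end

section \<open>Majorization\<close>

lemma sum_list_take_nth:
  "k \<le> length ws \<Longrightarrow> sum_list (take k ws) = (\<Sum>i<k. ws ! i)" for ws :: "real list"
  by (simp add: sum_list_sum_nth atLeast0LessThan min_def)

text \<open>The weights \<open>t\<close> are compared with the indicator \<open>s\<close> of the
  first \<open>k\<close> indices, which has the same sum. Relative to the threshold
  \<open>\<tau>\<close>, the last of the first \<open>k\<close> entries, every term favours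
  \<open>s\<close>.\<close>

lemma sum_weighted_le_sum_take:
  fixes ws :: "real list"
  assumes ws: "sorted_wrt (\<ge>) ws" and k: "k \<le> length ws"
    and t: "\<And>i. i < length ws \<Longrightarrow> 0 \<le> t i \<and> t i \<le> 1"
    and sum: "(\<Sum>i<length ws. t i) = real k"
  shows "(\<Sum>i<length ws. ws ! i * t i) \<le> sum_list (take k ws)"
proof (cases k)
  case 0
  then have "\<forall>i\<in>{..<length ws}. t i = 0"
    using sum t by (subst sum_nonneg_eq_0_iff[symmetric]) auto
  then show ?thesis using 0 by simp
next
  case (Suc l)
  let ?n = "length ws"
  define \<tau> where "\<tau> = ws ! l"
  define s where "s i = (if i < k then 1 else 0 :: real)" for i
  have split: "{..<?n} \<inter> {i. i < k} = {..<k}"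
    using k by auto
  have s1: "(\<Sum>i<?n. s i) = real k" and s2: "(\<Sum>i<?n. ws ! i * s i) = (\<Sum>i<k. ws ! i)"
    by (simp_all add: s_def if_distrib[of "\<lambda>u. _ * u"] sum.If_cases split cong: if_cong)
  have mono: "ws ! j \<le> ws ! i" if "i \<le> j" "j < ?n" for i j
    using sorted_wrt_nth_less[OF ws, of i j] that by (cases "i = j") auto
  have "(ws ! i - \<tau>) * (t i - s i) \<le> 0" if "i < ?n" for i
  proof (cases "i < k")
    case True
    then show ?thesis
      using mono[of i l] t[OF that] k Suc
      by (simp add: s_def \<tau>_def mult_nonneg_nonpos)
  next
    case False
    then show ?thesis
      using mono[of l i] t[OF that] that k Suc
      by (simp add: s_def \<tau>_def mult_nonpos_nonneg)
  qed
  then have "(\<Sum>i<?n. (ws ! i - \<tau>) * (t i - s i)) \<le> 0"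
    by (intro sum_nonpos) auto
  also have "(\<Sum>i<?n. (ws ! i - \<tau>) * (t i - s i))
    = (\<Sum>i<?n. ws ! i * t i) - (\<Sum>i<?n. ws ! i * s i) - \<tau> * ((\<Sum>i<?n. t i) - (\<Sum>i<?n. s i))"
    by (simp add: left_diff_distrib right_diff_distrib sum_subtractf sum_distrib_left)
  finally show ?thesis
    using sum s1 s2 k by (simp add: sum_list_take_nth)
qed

lemma decreasing_sorted: "sorted_wrt (\<ge>) (decreasing xs)"
  by (simp add: decreasing_def sorted_wrt_rev)

lemma length_decreasing [simp]: "length (decreasing xs) = length xs"
  by (simp add: decreasing_def)

lemma set_decreasing [simp]: "set (decreasing xs) = set xs"
  by (simp add: decreasing_def)

lemma decreasing_eq:
  assumes "sorted_wrt (\<ge>) xs"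
  shows "decreasing xs = xs"
proof -
  have "sort xs = rev xs"
    using assms by (intro properties_for_sort) (simp_all add: sorted_wrt_rev)
  then show ?thesis by (simp add: decreasing_def)
qed

lemma sum_weighted_le_sum_take_decreasing:
  assumes k: "k \<le> length xs"
    and t: "\<And>i. i < length xs \<Longrightarrow> 0 \<le> t i \<and> t i \<le> 1"
    and sum: "(\<Sum>i<length xs. t i) = real k"
  shows "(\<Sum>i<length xs. xs ! i * t i) \<le> sum_list (take k (decreasing xs))"
proof -
  have "mset (decreasing xs) = mset xs"
    by (simp add: decreasing_def)
  then obtain f where f: "bij_betw f {..<length xs} {..<length xs}"
    and nth: "\<And>i. i < length xs \<Longrightarrow> decreasing xs ! i = xs ! f i"
    using permutation_Ex_bij[of "decreasing xs" xs] by auto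
  have "(\<Sum>i<length xs. xs ! i * t i) = (\<Sum>i<length xs. xs ! f i * t (f i))"
    by (rule sum.reindex_bij_betw[OF f, symmetric])
  also have "\<dots> = (\<Sum>i<length (decreasing xs). decreasing xs ! i * t (f i))"
    by (simp add: nth)
  also have "\<dots> \<le> sum_list (take k (decreasing xs))"
  proof (rule sum_weighted_le_sum_take)
    show "(\<Sum>i<length (decreasing xs). t (f i)) = real k"
      using sum sum.reindex_bij_betw[OF f, of t] by simp
    show "0 \<le> t (f i) \<and> t (f i) \<le> 1" if "i < length (decreasing xs)" for i
      using t bij_betwE[OF f] that by auto
  qed (use k decreasing_sorted in auto)
  finally show ?thesis .
qed

text \<open>Abel summation: the induction keeps the boundary term \<open>\<mu> m * U (Suc m)\<close>
  as a lower bound, which decreasing weights and nonnegative partial sums preserve.\<close>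

lemma abel_sum_mono:
  fixes \<mu> r s :: "nat \<Rightarrow> real"
  assumes nonneg: "\<And>i. i < n \<Longrightarrow> 0 \<le> \<mu> i"
    and dec: "\<And>i. Suc i < n \<Longrightarrow> \<mu> (Suc i) \<le> \<mu> i"
    and le: "\<And>m. m \<le> n \<Longrightarrow> (\<Sum>i<m. r i) \<le> (\<Sum>i<m. s i)"
  shows "(\<Sum>i<n. \<mu> i * r i) \<le> (\<Sum>i<n. \<mu> i * s i)"
proof -
  define U where "U m = (\<Sum>i<m. s i - r i)" for m
  have U: "0 \<le> U m" if "m \<le> n" for m
    using le[OF that] by (simp add: U_def sum_subtractf)
  have *: "\<mu> m * U (Suc m) \<le> (\<Sum>i<Suc m. \<mu> i * (s i - r i))" if "m < n" for m
    using that
  proof (induction m)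
    case 0
    then show ?case by (simp add: U_def)
  next
    case (Suc m)
    have "\<mu> (Suc m) * U (Suc m) \<le> \<mu> m * U (Suc m)"
      using Suc.prems dec[of m] U[of "Suc m"] by (intro mult_right_mono) auto
    then show ?case
      using Suc by (simp add: U_def algebra_simps)
  qed
  have "0 \<le> (\<Sum>i<n. \<mu> i * (s i - r i))"
  proof (cases n)
    case (Suc m)
    then have "0 \<le> \<mu> m * U (Suc m)"
      using nonneg[of m] U[of n] by simp
    then show ?thesis using *[of m] Suc by simp
  qed simp
  then show ?thesis
    by (simp add: right_diff_distrib sum_subtractf)
qed

lemma sorted_cprod:
  assumes "sorted_wrt (\<ge>) xs" "sorted_wrt (\<ge>) ys" "\<forall>x\<in>set xs. 0 \<le> x" "\<forall>y\<in>set ys. 0 \<le> y"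
  shows "sorted_wrt (\<ge>) (cprod xs ys)"
  unfolding cprod_def sorted_wrt_iff_nth_less
  using assms by (auto simp: sorted_wrt_iff_nth_less intro!: mult_mono)

section \<open>Sublinear functions and semidefinite matrices\<close>

text \<open>Positive homogeneity makes \<open>\<phi>\<close> linear on each half-line; on the
  opposite half-line each linear bound is nonpositive.\<close>

lemma sublinear_nonneg:
  assumes "sublinear \<phi>" "\<forall>t. 0 \<le> \<phi> t"
  shows "t * \<phi> 1 \<le> \<phi> t" "- t * \<phi> (- 1) \<le> \<phi> t" "\<phi> t = t * \<phi> 1 \<or> \<phi> t = - t * \<phi> (- 1)"
proof -
  have hom: "\<phi> (\<mu> * t) = \<mu> * \<phi> t" if "0 \<le> \<mu>" for \<mu> t
    using assms(1) that by (simp add: sublinear_def)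
  have pos: "\<phi> t = t * \<phi> 1" if "0 \<le> t"
    using hom[OF that, of 1] by simp
  have neg: "\<phi> t = - t * \<phi> (- 1)" if "t \<le> 0"
    using hom[of "- t" "- 1"] that by simp
  have nonneg: "0 \<le> \<phi> 1" "0 \<le> \<phi> (- 1)" "0 \<le> \<phi> t"
    using assms(2) by auto
  show "t * \<phi> 1 \<le> \<phi> t"
    using pos nonneg mult_nonpos_nonneg[of t "\<phi> 1"] by (cases "0 \<le> t") auto
  show "- t * \<phi> (- 1) \<le> \<phi> t"
  proof (cases "t \<le> 0")
    case False
    then have "0 \<le> t * \<phi> (- 1)"
      using nonneg(2) by simp
    then show ?thesis using nonneg(3) by linarith
  qed (simp add: neg)
  show "\<phi> t = t * \<phi> 1 \<or> \<phi> t = - t * \<phi> (- 1)"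
    using pos neg by linarith
qed

lemma sublinear_abs: "sublinear abs"
  by (simp add: sublinear_def abs_mult abs_triangle_ineq)

lemma symmetric_psdD:
  assumes "symmetric_psd n A"
  shows "i < n \<Longrightarrow> j < n \<Longrightarrow> A $$ (i, j) = A $$ (j, i)"
    and "0 \<le> (\<Sum>i<n. \<Sum>j<n. x i * A $$ (i, j) * x j)"
    and "length (diag_mat A) = n" and "i < n \<Longrightarrow> diag_mat A ! i = A $$ (i, i)"
proof -
  have A: "A \<in> carrier_mat n n" and sym: "transpose_mat A = A"
    and psd: "\<forall>v \<in> carrier_vec n. 0 \<le> scalar_prod v (mult_mat_vec A v)"
    using assms by (auto simp: symmetric_psd_def)
  show "A $$ (i, j) = A $$ (j, i)" if "i < n" "j < n"
    using sym A that by (metis carrier_matD index_transpose_mat(1))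
  have "scalar_prod (vec n x) (mult_mat_vec A (vec n x)) = (\<Sum>i<n. \<Sum>j<n. x i * A $$ (i, j) * x j)"
    using A by (simp add: scalar_prod_def atLeast0LessThan sum_distrib_left mult.assoc)
  then show "0 \<le> (\<Sum>i<n. \<Sum>j<n. x i * A $$ (i, j) * x j)"
    using psd by (metis vec_carrier)
  show "length (diag_mat A) = n" "i < n \<Longrightarrow> diag_mat A ! i = A $$ (i, i)"
    using A by (simp_all add: diag_mat_def)
qed

section \<open>Trace form, positive cone and effects\<close>

locale trace_jordan_algebra = euclidean_jordan_algebra +
  assumes inner_eq_trace: "inner x y = jordan_trace jp e (jp x y)"
begin

lemma jordan_eigenvalues_spectral:
  "sorted_wrt (\<ge>) (jordan_eigenvalues jp e x)"
  "\<exists>c. spectral_decomposition jp e x (jordan_eigenvalues jp e x) c"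
proof -
  have "\<exists>ws. sorted_wrt (\<ge>) ws \<and> (\<exists>c. spectral_decomposition jp e x ws c)"
    using spectral_decomposition_exists by blast
  from someI_ex[OF this] show "sorted_wrt (\<ge>) (jordan_eigenvalues jp e x)"
    "\<exists>c. spectral_decomposition jp e x (jordan_eigenvalues jp e x) c"
    unfolding jordan_eigenvalues_def by blast+
qed

lemma spectral_decompositionD:
  assumes "spectral_decomposition jp e x ws g"
  shows "jordan_frame_algebra jp e (length ws) g" "x = (\<Sum>i<length ws. (ws ! i) *\<^sub>R g i)"
  using assms euclidean_jordan_algebra_axioms
  by (auto simp: spectral_decomposition_def jordan_frame_algebra_def jordan_frame_algebra_axioms_def)

lemma inner_unit: "inner x e = sum_list (jordan_eigenvalues jp e x)"
  by (simp add: inner_eq_trace jp_unit jordan_trace_def)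

text \<open>In a spectral decomposition of \<open>f\<close>, idempotency allows only the eigenvalues
  0 and 1, and primitivity identifies every frame element of eigenvalue 1 with \<open>f\<close>.
  Orthogonality leaves exactly one, so the trace is 1.\<close>

lemma inner_primitive_self:
  assumes f: "primitive_idempotent jp f"
  shows "inner f f = 1"
proof -
  let ?ws = "jordan_eigenvalues jp e f"
  let ?n = "length ?ws"
  obtain c where c: "spectral_decomposition jp e f ?ws c"
    using jordan_eigenvalues_spectral(2) by blast
  interpret jordan_frame_algebra jp e ?n c
    by (rule spectral_decompositionD[OF c])
  note ff = primitive_idempotentD[OF f]
  have f_sum: "f = (\<Sum>i<?n. ?ws ! i *\<^sub>R c i)"
    by (rule spectral_decompositionD[OF c])
  have cf: "jp (c i) f = ?ws ! i *\<^sub>R c i" if "i < ?n" for i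
    using frame_jp_sum[OF that, of "\<lambda>i. ?ws ! i"] f_sum by simp
  have eq: "?ws ! i = 1" "c i = f" if i: "i < ?n" "?ws ! i \<noteq> 0" for i
  proof -
    have "jp (c i) (jp f f) = (?ws ! i * ?ws ! i) *\<^sub>R c i"
    proof -
      have "jp f f = (\<Sum>j<?n. ?ws ! j *\<^sub>R jp (c j) f)"
        by (subst (1) f_sum) (simp add: jp_sum_left jp_simps)
      also have "\<dots> = (\<Sum>j<?n. (?ws ! j * ?ws ! j) *\<^sub>R c j)"
        by (simp add: cf)
      finally show ?thesis
        using frame_jp_sum[OF i(1), of "\<lambda>j. ?ws ! j * ?ws ! j"] by simp
    qed
    then have "(?ws ! i * ?ws ! i) *\<^sub>R c i = ?ws ! i *\<^sub>R c i"
      using cf[OF i(1)] ff(1) by simp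
    then show 1: "?ws ! i = 1"
      using i frame_nonzero by simp
    show "c i = f"
      using primitive_idempotent_eq[OF f frame_idempotent frame_nonzero] cf[OF i(1)] i(1) 1
      by (simp add: jp_commute[of f])
  qed
  have "\<exists>i<?n. ?ws ! i \<noteq> 0"
  proof (rule ccontr)
    assume "\<not> ?thesis"
    then have "(\<Sum>i<?n. ?ws ! i *\<^sub>R c i) = 0" by simp
    then show False using f_sum ff(2) by simp
  qed
  then obtain i where i: "i < ?n" "?ws ! i \<noteq> 0" by blast
  have "?ws ! j = 0" if "j < ?n" "j \<noteq> i" for j
    using eq(2)[OF that(1)] eq(2)[OF i] frame_jp[OF that(1) i(1)] that frame_nonzero[OF i(1)]
      frame_idempotent[OF i(1)] by metis
  then have "(\<Sum>j<?n. ?ws ! j) = (\<Sum>j<?n. if j = i then 1 else 0)"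
    using eq(1)[OF i] by (intro sum.cong) auto
  then have "sum_list ?ws = 1"
    using i(1) by (simp add: sum_list_sum_nth atLeast0LessThan)
  moreover have "inner f f = inner f e"
    using inner_jp_left[of f f e] ff(1) by (simp add: jp_unit)
  ultimately show ?thesis
    by (simp add: inner_unit)
qed

lemma inner_primitive_unit:
  assumes "primitive_idempotent jp f"
  shows "inner f e = 1"
  using inner_primitive_self[OF assms] inner_jp_left[of f f e] primitive_idempotentD[OF assms]
  by (simp add: jp_unit)

lemma inner_frame:
  assumes "jordan_frame_algebra jp e n g" "i < n" "j < n"
  shows "inner (g i) (g j) = (if i = j then 1 else 0)"
proof -
  interpret g: jordan_frame_algebra jp e n g by fact
  show ?thesis
    using inner_primitive_self[OF g.frame_primitive] g.frame_orthogonal inner_eq_0 assms by simp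
qed

lemma frame_length:
  assumes "jordan_frame_algebra jp e n g"
  shows "real n = inner e e"
proof -
  interpret g: jordan_frame_algebra jp e n g by fact
  have "inner e e = (\<Sum>i<n. inner (g i) e)"
    by (subst (1) g.frame_sum[symmetric]) (simp add: inner_sum_left)
  then show ?thesis
    by (simp add: inner_primitive_unit g.frame_primitive)
qed

lemma length_jordan_eigenvalues:
  assumes "jordan_frame_algebra jp e n g"
  shows "length (jordan_eigenvalues jp e x) = n"
  using jordan_eigenvalues_spectral(2)[of x] spectral_decompositionD(1) frame_length assms
  by (metis of_nat_eq_iff)

text \<open>The symmetric cone in its dual description, for which closure under nonnegative
  combinations is immediate; \<open>positive_decompose\<close> recovers nonnegative
  eigenvalues.\<close>

definition positive :: "'a \<Rightarrow> bool" where
  "positive x \<longleftrightarrow> (\<forall>f. primitive_idempotent jp f \<longrightarrow> 0 \<le> inner x f)"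

lemma positiveD: "positive x \<Longrightarrow> primitive_idempotent jp f \<Longrightarrow> 0 \<le> inner x f"
  by (simp add: positive_def)

lemma positive_sum:
  assumes "\<And>i. i \<in> I \<Longrightarrow> 0 \<le> w i \<and> positive (x i)"
  shows "positive (\<Sum>i\<in>I. w i *\<^sub>R x i)"
  using assms by (auto simp: positive_def inner_sum_left intro!: sum_nonneg mult_nonneg_nonneg)

lemma positive_primitive: "primitive_idempotent jp f \<Longrightarrow> positive f"
  using inner_idempotents_nonneg primitive_idempotentD(1) by (simp add: positive_def)

lemma frame_coeff:
  assumes "jordan_frame_algebra jp e n g" "i < n"
  shows "inner (\<Sum>j<n. w j *\<^sub>R g j) (g i) = w i"
proof -
  have "inner (\<Sum>j<n. w j *\<^sub>R g j) (g i) = (\<Sum>j<n. if j = i then w j else 0)"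
    unfolding inner_sum_left using assms by (intro sum.cong) (auto simp: inner_frame)
  then show ?thesis using assms(2) by simp
qed

lemma positive_frame_coeff:
  assumes "jordan_frame_algebra jp e n g" "i < n" "x = (\<Sum>j<n. w j *\<^sub>R g j)" "positive x"
  shows "0 \<le> w i"
  using positiveD[OF assms(4) jordan_frame_algebra.frame_primitive[OF assms(1,2)]]
    frame_coeff[OF assms(1,2), of w] assms(3) by simp

lemma positive_decompose:
  assumes "positive x"
  obtains n g w where "jordan_frame_algebra jp e n g" "x = (\<Sum>i<n. w i *\<^sub>R g i)"
    "\<And>i. i < n \<Longrightarrow> 0 \<le> w i"
proof -
  obtain g where g: "spectral_decomposition jp e x (jordan_eigenvalues jp e x) g"
    using jordan_eigenvalues_spectral(2) by blast
  note gD = spectral_decompositionD[OF g]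
  show thesis
  proof
    show "0 \<le> jordan_eigenvalues jp e x ! i" if "i < length (jordan_eigenvalues jp e x)" for i
      using positive_frame_coeff[OF gD(1) that gD(2) assms] .
  qed (fact gD)+
qed

lemma inner_positive:
  assumes "positive x" "positive y"
  shows "0 \<le> inner x y"
proof -
  obtain n g w where g: "jordan_frame_algebra jp e n g" "x = (\<Sum>i<n. w i *\<^sub>R g i)"
    "\<And>i. i < n \<Longrightarrow> 0 \<le> w i"
    using positive_decompose[OF assms(1)] by metis
  have "0 \<le> inner (g i) y" if "i < n" for i
    using positiveD[OF assms(2) jordan_frame_algebra.frame_primitive[OF g(1) that]]
    by (simp add: inner_commute)
  then show ?thesis
    using g(2,3) by (auto simp: inner_sum_left intro!: sum_nonneg mult_nonneg_nonneg)
qed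

definition effect :: "'a \<Rightarrow> bool" where
  "effect q \<longleftrightarrow> positive q \<and> positive (e - q)"

lemma effect_inner_primitive:
  assumes "effect q" "primitive_idempotent jp f"
  shows "0 \<le> inner q f" "inner q f \<le> 1"
  using positiveD[of q, OF _ assms(2)] positiveD[of "e - q", OF _ assms(2)] assms(1)
    inner_primitive_unit[OF assms(2)]
  by (auto simp: effect_def inner_diff_left inner_commute[of e])

lemma effect_frame:
  assumes "jordan_frame_algebra jp e n g" "\<And>i. i < n \<Longrightarrow> 0 \<le> t i \<and> t i \<le> 1"
  shows "effect (\<Sum>i<n. t i *\<^sub>R g i)"
proof -
  interpret g: jordan_frame_algebra jp e n g by fact
  have "e - (\<Sum>i<n. t i *\<^sub>R g i) = (\<Sum>i<n. (1 - t i) *\<^sub>R g i)"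
    by (simp add: scaleR_diff_left sum_subtractf g.frame_sum)
  then show ?thesis
    unfolding effect_def
    using assms(2) g.frame_primitive positive_primitive by (auto intro!: positive_sum)
qed

lemma inner_frame_sum_unit:
  assumes "jordan_frame_algebra jp e n g"
  shows "inner (\<Sum>i<n. t i *\<^sub>R g i) e = (\<Sum>i<n. t i)"
  using jordan_frame_algebra.frame_primitive[OF assms]
  by (simp add: inner_sum_left inner_primitive_unit)

lemma effect_frame_initial:
  assumes "jordan_frame_algebra jp e n g" "k \<le> n"
  shows "effect (\<Sum>i<k. g i)" "inner (\<Sum>i<k. g i) e = real k"
proof -
  let ?t = "\<lambda>i. if i < k then 1 else 0 :: real"
  have eq: "(\<Sum>i<k. g i) = (\<Sum>i<n. ?t i *\<^sub>R g i)"
    using assms(2) by (intro sum.mono_neutral_cong_left) auto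
  show "effect (\<Sum>i<k. g i)"
    unfolding eq by (intro effect_frame assms) auto
  show "inner (\<Sum>i<k. g i) e = real k"
    using assms(2) jordan_frame_algebra.frame_primitive[OF assms(1)]
    by (simp add: inner_sum_left inner_primitive_unit)
qed

lemma sum_inner_frame:
  assumes "jordan_frame_algebra jp e n g"
  shows "(\<Sum>i<n. inner q (g i)) = inner q e"
  by (simp add: inner_sum_right[symmetric] jordan_frame_algebra.frame_sum[OF assms])

text \<open>In an eigenframe of \<open>x\<close> the inner product is a sum of eigenvalues with
  weights in [0,1] of total \<open>k\<close>.\<close>

lemma ky_fan:
  assumes q: "effect q" "inner q e = real k" and g: "jordan_frame_algebra jp e n g" and k: "k \<le> n"
  shows "inner x q \<le> sum_list (take k (jordan_eigenvalues jp e x))"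
proof -
  let ?ws = "jordan_eigenvalues jp e x"
  obtain h where h: "spectral_decomposition jp e x ?ws h"
    using jordan_eigenvalues_spectral(2) by blast
  note hD = spectral_decompositionD[OF h]
  have "inner x q = (\<Sum>i<length ?ws. ?ws ! i * inner q (h i))"
    by (subst hD(2)) (simp add: inner_sum_left inner_commute[of q])
  also have "\<dots> \<le> sum_list (take k ?ws)"
    using jordan_eigenvalues_spectral(1) length_jordan_eigenvalues[OF g] k q
      effect_inner_primitive[OF q(1) jordan_frame_algebra.frame_primitive[OF hD(1)]]
      sum_inner_frame[OF hD(1), of q]
    by (intro sum_weighted_le_sum_take) auto
  finally show ?thesis .
qed

lemma loewner_map_spectral:
  obtains ws g where "spectral_decomposition jp e x ws g"
    "loewner_map jp e \<phi> x = (\<Sum>i<length ws. \<phi> (ws ! i) *\<^sub>R g i)"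
proof -
  have "\<exists>y ws g. spectral_decomposition jp e x ws g \<and> y = (\<Sum>i<length ws. \<phi> (ws ! i) *\<^sub>R g i)"
    using spectral_decomposition_exists by blast
  from someI_ex[OF this] show thesis
    using that unfolding loewner_map_def by blast
qed

end

section \<open>Majorization for Schur products\<close>

locale trace_jordan_frame_algebra = trace_jordan_algebra + jordan_frame_algebra +
  fixes A :: "real mat"
  assumes psd: "symmetric_psd n A"
begin

abbreviation schur :: "'a \<Rightarrow> 'a" where
  "schur \<equiv> schur_map (\<lambda>i j. A $$ (i, j))"

lemma schur_product_schur: "schur_product jp n c A x = schur x"
  by (rule schur_product_eq) (rule symmetric_psdD[OF psd])

lemma positive_schur:
  assumes "positive x"
  shows "positive (schur x)"
  unfolding positive_def
proof (intro allI impI)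
  fix f assume f: "primitive_idempotent jp f"
  obtain m g w where g: "jordan_frame_algebra jp e m g" "x = (\<Sum>i<m. w i *\<^sub>R g i)"
    "\<And>i. i < m \<Longrightarrow> 0 \<le> w i"
    using positive_decompose[OF assms] by metis
  have "0 \<le> inner (schur (g i)) f" if "i < m" for i
    using jordan_frame_algebra.frame_primitive[OF g(1) that] f symmetric_psdD(1,2)[OF psd]
    by (intro inner_schur_map_nonneg primitive_idempotentD(1)) auto
  then show "0 \<le> inner (schur x) f"
    using g(3) by (auto simp: g(2) linear_sum[OF linear_schur_map] linear_scale[OF linear_schur_map]
        inner_sum_left intro!: sum_nonneg mult_nonneg_nonneg)
qed

abbreviation diag :: "real list" where
  "diag \<equiv> decreasing (diag_mat A)"

text \<open>Self-adjointness moves the Schur product to \<open>e\<close>, where it becomes the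
  diagonal of \<open>A\<close> in the frame \<open>c\<close>; the numbers
  \<open>inner q (c i)\<close> serve as weights.\<close>

lemma inner_schur_unit:
  assumes "effect q" "inner q e = real k" "k \<le> n"
  shows "inner (schur q) e \<le> sum_list (take k diag)"
proof -
  note A = symmetric_psdD[OF psd]
  have "inner (schur q) e = (\<Sum>i<length (diag_mat A). diag_mat A ! i * inner q (c i))"
    unfolding inner_schur_map schur_map_unit by (simp add: inner_sum_right A)
  also have "\<dots> \<le> sum_list (take k diag)"
    using assms effect_inner_primitive[OF assms(1) frame_primitive]
      sum_inner_frame[OF jordan_frame_algebra_axioms, of q]
    by (intro sum_weighted_le_sum_take_decreasing) (auto simp: A)
  finally show ?thesis .
qed

lemma inner_schur_effects:
  assumes p: "effect p" "inner p e = real m" "m \<le> n" and q: "effect q" "inner q e = real k" "k \<le> n"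
  shows "inner (schur p) q \<le> sum_list (take (min m k) diag)"
proof -
  have *: "inner (schur p) q \<le> sum_list (take m diag)"
    if p: "effect p" "inner p e = real m" "m \<le> n" and q: "effect q" for p q m
  proof -
    have "0 \<le> inner (schur p) (e - q)"
      using p q by (intro inner_positive positive_schur) (auto simp: effect_def)
    then show ?thesis
      using inner_schur_unit[OF p] by (simp add: inner_diff_right)
  qed
  have "inner (schur p) q = inner (schur q) p"
    by (subst inner_schur_map) (rule inner_commute)
  then show ?thesis
    using *[OF p q(1)] *[OF q p(1)] by (simp add: min_def)
qed

lemma diag_nonneg: "\<forall>x\<in>set diag. 0 \<le> x"
proof -
  have "0 \<le> A $$ (i, i)" if "i < n" for i
    using symmetric_psdD(2)[OF psd, of "\<lambda>j. if j = i then 1 else 0"] that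
    by (simp add: if_distrib[of "\<lambda>t. t * _"] if_distrib[of "\<lambda>t. _ * t"] cong: if_cong)
  then show ?thesis
    using symmetric_psdD(3,4)[OF psd] by (auto simp: in_set_conv_nth)
qed

lemma inner_schur_positive:
  assumes y: "positive y" and q: "effect q" "inner q e = real k" "k \<le> n"
  shows "inner (schur y) q \<le> sum_list (take k (cprod diag (jordan_eigenvalues jp e y)))"
proof -
  let ?\<mu> = "jordan_eigenvalues jp e y"
  obtain h where h: "spectral_decomposition jp e y ?\<mu> h"
    using jordan_eigenvalues_spectral(2) by blast
  have len: "length ?\<mu> = n"
    using length_jordan_eigenvalues[OF jordan_frame_algebra_axioms] .
  have hf: "jordan_frame_algebra jp e n h" and y_sum: "y = (\<Sum>i<n. ?\<mu> ! i *\<^sub>R h i)"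
    using spectral_decompositionD[OF h] len by simp_all
  have d: "length diag = n"
    using symmetric_psdD(3)[OF psd] by simp
  have "inner (schur y) q = (\<Sum>j<n. ?\<mu> ! j * inner (schur (h j)) q)"
    by (subst y_sum) (simp add: linear_sum[OF linear_schur_map] linear_scale[OF linear_schur_map] inner_sum_left)
  \<comment> \<open>The comparison sequence is cut off at \<open>k\<close>, so that its partial sums
    match the bounds of \<open>inner_schur_effects\<close>.\<close>
  also have "\<dots> \<le> (\<Sum>j<n. ?\<mu> ! j * (if j < k then diag ! j else 0))"
  proof (rule abel_sum_mono)
    show "0 \<le> ?\<mu> ! i" if "i < n" for i
      using positive_frame_coeff[OF hf that y_sum y] .
    show "?\<mu> ! Suc i \<le> ?\<mu> ! i" if "Suc i < n" for i
      using sorted_wrt_nth_less[OF jordan_eigenvalues_spectral(1)[of y], of i "Suc i"] that len by simp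
    show "(\<Sum>j<m. inner (schur (h j)) q) \<le> (\<Sum>j<m. if j < k then diag ! j else 0)" if m: "m \<le> n" for m
    proof -
      have "(\<Sum>j<m. inner (schur (h j)) q) = inner (schur (\<Sum>j<m. h j)) q"
        by (simp add: linear_sum[OF linear_schur_map] inner_sum_left)
      also have "\<dots> \<le> sum_list (take (min m k) diag)"
        by (rule inner_schur_effects[OF effect_frame_initial[OF hf m] m q])
      also have "\<dots> = (\<Sum>j<min m k. diag ! j)"
        using m d by (subst sum_list_take_nth) auto
      also have "\<dots> = (\<Sum>j<m. if j < k then diag ! j else 0)"
        by (intro sum.mono_neutral_cong_left) auto
      finally show ?thesis .
    qed
  qed
  also have "\<dots> = (\<Sum>j<k. diag ! j * ?\<mu> ! j)"
    using q(3) by (intro sum.mono_neutral_cong_right) auto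
  also have "\<dots> = sum_list (take k (cprod diag ?\<mu>))"
    using q(3) d len by (subst sum_list_take_nth) (simp_all add: cprod_def)
  finally show ?thesis .
qed

lemma positive_loewner_map:
  assumes "\<forall>t. 0 \<le> \<phi> t"
  shows "positive (loewner_map jp e \<phi> x)"
proof -
  obtain ws g where g: "spectral_decomposition jp e x ws g"
    and eq: "loewner_map jp e \<phi> x = (\<Sum>i<length ws. \<phi> (ws ! i) *\<^sub>R g i)"
    using loewner_map_spectral .
  show ?thesis
    unfolding eq using assms jordan_frame_algebra.frame_primitive[OF spectral_decompositionD(1)[OF g]]
    by (intro positive_sum) (simp add: positive_primitive)
qed

text \<open>Both majorizations rest on this one effect \<open>q\<close>: the first bounds the right
  side by \<open>ky_fan\<close>, the second by \<open>inner_schur_positive\<close>.\<close>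

lemma sum_take_loewner_schur:
  assumes \<phi>: "sublinear \<phi>" "\<forall>t. 0 \<le> \<phi> t" and k: "k \<le> n"
  obtains q where "effect q" "inner q e = real k"
    "sum_list (take k (jordan_eigenvalues jp e (loewner_map jp e \<phi> (schur b))))
      \<le> inner (schur (loewner_map jp e \<phi> b)) q"
proof -
  let ?y = "loewner_map jp e \<phi> b" and ?z = "loewner_map jp e \<phi> (schur b)"
  let ?ws = "jordan_eigenvalues jp e ?z"
  note \<phi>_le = sublinear_nonneg[OF \<phi>]
  obtain bs g where b: "spectral_decomposition jp e b bs g"
    and y: "?y = (\<Sum>i<length bs. \<phi> (bs ! i) *\<^sub>R g i)"
    using loewner_map_spectral .
  note gD = spectral_decompositionD[OF b]
  have g_pos: "positive (g i)" if "i < length bs" for i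
    using positive_primitive jordan_frame_algebra.frame_primitive[OF gD(1)] that by blast
  have "?y - \<phi> 1 *\<^sub>R b = (\<Sum>i<length bs. (\<phi> (bs ! i) - bs ! i * \<phi> 1) *\<^sub>R g i)"
    unfolding y by (subst gD(2))
      (simp add: scaleR_sum_right scaleR_diff_left sum_subtractf mult.commute)
  then have "positive (?y - \<phi> 1 *\<^sub>R b)"
    using \<phi>_le(1) g_pos by (auto intro!: positive_sum)
  moreover have "?y - (- \<phi> (- 1)) *\<^sub>R b = (\<Sum>i<length bs. (\<phi> (bs ! i) - (- (bs ! i)) * \<phi> (- 1)) *\<^sub>R g i)"
    unfolding y by (subst gD(2))
      (simp add: scaleR_sum_right scaleR_add_left sum.distrib sum_negf mult.commute)
  then have "positive (?y - (- \<phi> (- 1)) *\<^sub>R b)"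
  proof (simp only:, intro positive_sum conjI)
    fix i assume "i \<in> {..<length bs}"
    then show "positive (g i)" using g_pos by simp
    show "0 \<le> \<phi> (bs ! i) - - bs ! i * \<phi> (- 1)" using \<phi>_le(2)[of "bs ! i"] by simp
  qed
  moreover have le: "r * inner (schur b) f \<le> inner (schur ?y) f"
    if "positive (?y - r *\<^sub>R b)" "primitive_idempotent jp f" for r f
    using positive_schur[OF that(1)] that(2)
    by (simp add: positive_def linear_diff[OF linear_schur_map] linear_scale[OF linear_schur_map]
        inner_diff_left)
  ultimately have bound: "\<phi> 1 * inner (schur b) f \<le> inner (schur ?y) f"
    "- \<phi> (- 1) * inner (schur b) f \<le> inner (schur ?y) f" if "primitive_idempotent jp f" for f
    using that by blast+
  obtain zs f where zs: "spectral_decomposition jp e (schur b) zs f"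
    and z: "?z = (\<Sum>i<length zs. \<phi> (zs ! i) *\<^sub>R f i)"
    using loewner_map_spectral .
  note fD = spectral_decompositionD[OF zs]
  \<comment> \<open>The value \<open>\<phi> (zs ! i)\<close> is one of the two linear expressions,
    and \<open>bound\<close> controls both.\<close>
  have \<phi>_zs: "\<phi> (zs ! i) \<le> inner (schur ?y) (f i)" if "i < length zs" for i
  proof -
    have "inner (schur b) (f i) = zs ! i"
      using frame_coeff[OF fD(1) that, of "\<lambda>i. zs ! i"] fD(2) by simp
    then show ?thesis
      using bound[OF jordan_frame_algebra.frame_primitive[OF fD(1) that]] \<phi>_le(3)[of "zs ! i"]
      by (auto simp: mult.commute)
  qed
  obtain h where h: "spectral_decomposition jp e ?z ?ws h"
    using jordan_eigenvalues_spectral(2) by blast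
  have len: "length ?ws = n"
    using length_jordan_eigenvalues[OF jordan_frame_algebra_axioms] .
  have hf: "jordan_frame_algebra jp e n h" and z_sum: "?z = (\<Sum>i<n. ?ws ! i *\<^sub>R h i)"
    using spectral_decompositionD[OF h] len by simp_all
  \<comment> \<open>The eigenframe \<open>h\<close> need not be \<open>f\<close>. Hence
    \<open>p\<close> is replaced by its diagonal part \<open>?q\<close> in the frame
    \<open>f\<close>: it is again an effect of trace \<open>k\<close>, and it has the same inner
    product with \<open>?z\<close>, which is diagonal in \<open>f\<close>.\<close>
  define p where "p = (\<Sum>i<k. h i)"
  have p: "effect p" "inner p e = real k"
    unfolding p_def by (rule effect_frame_initial[OF hf k])+
  define t where "t i = inner p (f i)" for i
  have t: "0 \<le> t i \<and> t i \<le> 1" if "i < length zs" for i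
    using effect_inner_primitive[OF p(1) jordan_frame_algebra.frame_primitive[OF fD(1) that]]
    by (simp add: t_def)
  let ?q = "\<Sum>i<length zs. t i *\<^sub>R f i"
  show thesis
  proof
    show "effect ?q"
      using effect_frame[OF fD(1)] t by blast
    show "inner ?q e = real k"
      using p(2) by (simp add: inner_frame_sum_unit[OF fD(1)] t_def sum_inner_frame[OF fD(1)])
    have "sum_list (take k ?ws) = (\<Sum>i<k. inner ?z (h i))"
      using k len frame_coeff[OF hf, of _ "\<lambda>i. ?ws ! i"] z_sum by (simp add: sum_list_take_nth)
    also have "\<dots> = (\<Sum>i<length zs. \<phi> (zs ! i) * t i)"
      unfolding inner_sum_right[symmetric] p_def[symmetric]
      by (subst z) (simp add: inner_sum_left t_def inner_commute[of p])
    also have "\<dots> \<le> (\<Sum>i<length zs. inner (schur ?y) (f i) * t i)"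
      using \<phi>_zs t by (intro sum_mono mult_right_mono) auto
    also have "\<dots> = inner (schur ?y) ?q"
      by (simp add: inner_sum_right mult.commute)
    finally show "sum_list (take k ?ws) \<le> inner (schur ?y) ?q" .
  qed
qed

lemma weakly_majorizedI:
  assumes "length ws = n" "sorted_wrt (\<ge>) ws"
    and "\<And>k. k \<le> n \<Longrightarrow>
      sum_list (take k (jordan_eigenvalues jp e x)) \<le> sum_list (take k ws)"
  shows "weakly_majorized (jordan_eigenvalues jp e x) ws"
  using assms length_jordan_eigenvalues[OF jordan_frame_algebra_axioms, of x]
    jordan_eigenvalues_spectral(1)[of x]
  by (simp add: weakly_majorized_def decreasing_eq)

lemma loewner_schur_majorized:
  assumes \<phi>: "sublinear \<phi>" "\<forall>t. 0 \<le> \<phi> t"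
  shows "weakly_majorized (jordan_eigenvalues jp e (loewner_map jp e \<phi> (schur b)))
      (jordan_eigenvalues jp e (schur (loewner_map jp e \<phi> b)))"
proof (rule weakly_majorizedI)
  fix k assume k: "k \<le> n"
  obtain q where q: "effect q" "inner q e = real k"
    "sum_list (take k (jordan_eigenvalues jp e (loewner_map jp e \<phi> (schur b))))
      \<le> inner (schur (loewner_map jp e \<phi> b)) q"
    using sum_take_loewner_schur[OF \<phi> k] .
  then show "sum_list (take k (jordan_eigenvalues jp e (loewner_map jp e \<phi> (schur b))))
    \<le> sum_list (take k (jordan_eigenvalues jp e (schur (loewner_map jp e \<phi> b))))"
    using ky_fan[OF q(1,2) jordan_frame_algebra_axioms k] order_trans by blast
qed (use length_jordan_eigenvalues[OF jordan_frame_algebra_axioms] jordan_eigenvalues_spectral(1) in auto)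

lemma loewner_schur_majorized_diag:
  assumes \<phi>: "sublinear \<phi>" "\<forall>t. 0 \<le> \<phi> t"
  shows "weakly_majorized (jordan_eigenvalues jp e (loewner_map jp e \<phi> (schur b)))
      (cprod diag (jordan_eigenvalues jp e (loewner_map jp e \<phi> b)))"
proof (rule weakly_majorizedI)
  let ?y = "loewner_map jp e \<phi> b"
  let ?\<mu> = "jordan_eigenvalues jp e ?y"
  have y: "positive ?y"
    using positive_loewner_map[OF \<phi>(2)] .
  have len: "length ?\<mu> = n"
    using length_jordan_eigenvalues[OF jordan_frame_algebra_axioms] .
  show "length (cprod diag ?\<mu>) = n"
    using len symmetric_psdD(3)[OF psd] by (simp add: cprod_def)
  obtain h where h: "spectral_decomposition jp e ?y ?\<mu> h"
    using jordan_eigenvalues_spectral(2) by blast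
  note hD = spectral_decompositionD[OF h]
  have "0 \<le> ?\<mu> ! i" if "i < length ?\<mu>" for i
    using positive_frame_coeff[OF hD(1) that hD(2) y] .
  \<comment> \<open>The product of nonnegative decreasing lists is decreasing, so it equals its own
    rearrangement.\<close>
  then show "sorted_wrt (\<ge>) (cprod diag ?\<mu>)"
    using decreasing_sorted jordan_eigenvalues_spectral(1) diag_nonneg
    by (intro sorted_cprod) (auto simp: in_set_conv_nth)
  fix k assume k: "k \<le> n"
  obtain q where q: "effect q" "inner q e = real k"
    "sum_list (take k (jordan_eigenvalues jp e (loewner_map jp e \<phi> (schur b)))) \<le> inner (schur ?y) q"
    using sum_take_loewner_schur[OF \<phi> k] .
  then show "sum_list (take k (jordan_eigenvalues jp e (loewner_map jp e \<phi> (schur b))))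
    \<le> sum_list (take k (cprod diag ?\<mu>))"
    using inner_schur_positive[OF y q(1,2) k] by linarith
qed

end

theorem theorem3p8:
  fixes jp :: "'a::euclidean_space \<Rightarrow> 'a \<Rightarrow> 'a" and e :: 'a
    and n :: nat and c :: "nat \<Rightarrow> 'a"
    and \<phi> :: "real \<Rightarrow> real" and A :: "real mat" and b :: 'a
  assumes "euclidean_jordan_algebra jp e"
    and "\<forall>x y. inner x y = jordan_trace jp e (jp x y)"
    and "jordan_rank jp e = n"
    and "sublinear \<phi>" and "\<forall>t. 0 \<le> \<phi> t"
    and "symmetric_psd n A"
    and "jordan_frame jp e n c"
  shows "jordan_weakly_majorized jp e
           (loewner_map jp e \<phi> (schur_product jp n c A b))
           (schur_product jp n c A (loewner_map jp e \<phi> b))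
       \<and> weakly_majorized
           (jordan_eigenvalues jp e (loewner_map jp e \<phi> (schur_product jp n c A b)))
           (cprod (decreasing (diag_mat A)) (jordan_eigenvalues jp e (loewner_map jp e \<phi> b)))
       \<and> weakly_majorized
           (jordan_eigenvalues jp e (jordan_abs jp e (schur_product jp n c A b)))
           (cprod (decreasing (diag_mat A)) (jordan_eigenvalues jp e (jordan_abs jp e b)))"
proof -
  interpret euclidean_jordan_algebra jp e by fact
  interpret trace_jordan_frame_algebra jp e n c A
    by unfold_locales (use assms in auto)
  show ?thesis
    using loewner_schur_majorized[OF assms(4,5), of b] loewner_schur_majorized_diag[OF assms(4,5), of b]
      loewner_schur_majorized_diag[OF sublinear_abs, of b]
    by (simp add: schur_product_schur jordan_weakly_majorized_def jordan_abs_def)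
qed

end
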